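(* Let $\mathcal{B}\in\mathcal{L}^2$ be a controllable single-input single-output system (i.e. $m(\mathcal{B})=p(\mathcal{B})=1$), and let $(u_d,y_d)\in\mathcal{B}_{[0,T]}$ with $u_d$ persistently exciting of order $L+n(\mathcal{B})$ for some $L\ge l(\mathcal{B})+n(\mathcal{B})+1$. Then the relative degree of the system is $r(\mathcal{B})=j^*-1$, where $j^*$ is the minimum of all integers $1\le j\le L-l(\mathcal{B})$ that satisfy $$\mathcal{H}_L(y_d)_{l(\mathcal{B})+j}^{\top}\notin \operatorname{im}\begin{bmatrix}\mathcal{H}_L(u_d)_{1,\ldots,l(\mathcal{B})}\\ \mathcal{H}_L(y_d)_{1,\ldots,l(\mathcal{B})}\end{bmatrix}^{\top}.$$ If there is no $1\le j\le n(\mathcal{B})+1$ that fulfills this condition, then $r(\mathcal{B})=\infty$.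
   Context: Discrete-time systems. $\mathcal{L}^w$ is the class of behaviors $\mathcal{B}\subseteq(\mathbb{R}^w)^{\mathbb{N}_0}$ that are linear subspaces, shift-invariant ($\sigma\mathcal{B}\subseteq\mathcal{B}$ with $(\sigma f)(t)=f(t+1)$) and closed under pointwise convergence. $\mathcal{B}_{[a,b]}$ is the set of restrictions to $\{a,\dots,b\}$ of trajectories in $\mathcal{B}$. The input cardinality $m(\mathcal{B})$ is the maximal dimension of a free subspace of signals (one whose components can follow any sequence irrespective of the past), and $p(\mathcal{B})=w-m(\mathcal{B})$. Signals are partitioned as $(u,y)$ with $u\in\mathbb{R}^{m(\mathcal{B})}$, $y\in\mathbb{R}^{p(\mathcal{B})}$. Every $\mathcal{B}\in\mathcal{L}^w$ has a state space representation $(A,B,C,D)$: $\mathcal{B}$ is the set of all $(u,y)$ for which there is a state sequence $x:\mathbb{N}_0\to\mathbb{R}^n$ with $x(t+1)=Ax(t)+Bu(t)$, $y(t)=Cx(t)+Du(t)$ for all $t\in\mathbb{N}_0$. It is minimal if $n$ is the smallest possible; this smallest $n$ is the McMillan degree $n(\mathcal{B})$. The lag $l(\mathcal{B})$ is the smallest $L\in\mathbb{N}_0$ such that, for a minimal representation, $[C^\top,(CA)^\top,\ldots,(CA^{L-1})^\top]^\top$ has rank $n(\mathcal{B})$ (independent of the minimal representation). $\mathcal{B}$ is controllable if for every $w_p\in\mathcal{B}_{[0,T]}$, $T\in\mathbb{N}$, and every $w_f\in\mathcal{B}$ there are $\tilde T\in\mathbb{N}$ and $v\in\mathcal{B}$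 with $v|_{[0,T]}=w_p$ and $v(t)=w_f(t-T-\tilde T)$ for all $t\ge T+\tilde T$. For $f:\{0,\dots,T\}\to\mathbb{R}^k$ and $L\le T+1$, the Hankel matrix $\mathcal{H}_L(f)$ has $L$ block rows and $T-L+2$ columns, with block $(i,j)$ equal to $f(i+j-2)$. $f$ is persistently exciting of order $L$ if $\operatorname{rk}\mathcal{H}_L(f)=Lk$. For a matrix $N$, $N_i$ is its $i$-th row and $N_{i,\ldots,j}$ the submatrix of rows $i$ through $j$. Relative degree of a SISO system with representation $(A,B,C,D)$ (independent of the representation): $r(\mathcal{B})=0$ if $D\ne0$; if $D=0$, $r(\mathcal{B})=r\ge1$ if $CA^kB=0$ for all $0\le k<r-1$ and $CA^{r-1}B\neq0$; and $r(\mathcal{B})=\infty$ if $D=0$ and $CA^{k}B=0$ for all $k\in\mathbb{N}_0$. *)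

theory Defs
  imports
    "Jordan_Normal_Form.DL_Rank"
    "HOL-Library.Extended_Nat"
    "HOL-Library.FuncSet"
    Complex_Main
begin

section \<open>Matrices\<close>

abbreviation mat_rank :: "real mat \<Rightarrow> nat" where
  "mat_rank M \<equiv> vec_space.rank (dim_row M) M"

abbreviation mat_im :: "real mat \<Rightarrow> real vec set" where
  "mat_im M \<equiv> vec_space.col_space (dim_row M) M"

text \<open>Rows are counted from 1 in the next two definitions, unlike in the matrix library.
  For \<open>j = i - 1\<close> the second one gives a matrix without rows.\<close>

definition nth_row :: "real mat \<Rightarrow> nat \<Rightarrow> real vec" where
  "nth_row N i = row N (i - 1)"

definition row_range :: "real mat \<Rightarrow> nat \<Rightarrow> nat \<Rightarrow> real mat" where
  "row_range N i j = mat (j + 1 - i) (dim_col N) (\<lambda>(a, b). N $$ (i - 1 + a, b))"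


section \<open>Behaviors\<close>

definition signals :: "nat \<Rightarrow> (nat \<Rightarrow> real vec) set" where
  "signals w = {f. \<forall>t. f t \<in> carrier_vec w}"

definition linear_behavior :: "nat \<Rightarrow> (nat \<Rightarrow> real vec) set \<Rightarrow> bool" where
  "linear_behavior w \<B> \<longleftrightarrow>
     \<B> \<subseteq> signals w \<and>
     (\<lambda>t. 0\<^sub>v w) \<in> \<B> \<and>
     (\<forall>f\<in>\<B>. \<forall>g\<in>\<B>. (\<lambda>t. f t + g t) \<in> \<B>) \<and>
     (\<forall>c. \<forall>f\<in>\<B>. (\<lambda>t. c \<cdot>\<^sub>v f t) \<in> \<B>)"

definition shift :: "(nat \<Rightarrow> real vec) \<Rightarrow> nat \<Rightarrow> real vec" where
  "shift f t = f (t + 1)"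

definition pointwise_closed :: "nat \<Rightarrow> (nat \<Rightarrow> real vec) set \<Rightarrow> bool" where
  "pointwise_closed w \<B> \<longleftrightarrow>
     (\<forall>F f. (\<forall>k::nat. F k \<in> \<B>) \<longrightarrow> f \<in> signals w \<longrightarrow>
        (\<forall>t. \<forall>i<w. (\<lambda>k. F k t $ i) \<longlonglongrightarrow> f t $ i) \<longrightarrow> f \<in> \<B>)"

definition behaviors :: "nat \<Rightarrow> (nat \<Rightarrow> real vec) set set" where
  "behaviors w = {\<B>. linear_behavior w \<B> \<and> shift ` \<B> \<subseteq> \<B> \<and> pointwise_closed w \<B>}"

text \<open>Restricted trajectories are functions that are \<^const>\<open>undefined\<close> outside the interval.\<close>

definition restrictions :: "nat \<Rightarrow> nat \<Rightarrow> (nat \<Rightarrow> real vec) set \<Rightarrow> (nat \<Rightarrow> real vec) set" where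
  "restrictions a b \<B> = (\<lambda>f. restrict f {a..b}) ` \<B>"

text \<open>A \<open>k\<close>-dimensional subspace of signals is given by a basis of linear functionals on the
  signal space, the rows of a \<open>k \<times> w\<close> matrix \<open>P\<close> of rank \<open>k\<close>. It is free if, whatever
  happened before time \<open>t\<close>, the components \<open>P w\<close> can follow any sequence from time \<open>t\<close> on.\<close>

definition free_components :: "(nat \<Rightarrow> real vec) set \<Rightarrow> real mat \<Rightarrow> bool" where
  "free_components \<B> P \<longleftrightarrow>
     (\<forall>f\<in>\<B>. \<forall>t. \<forall>v\<in>signals (dim_row P).
        \<exists>g\<in>\<B>. (\<forall>s<t. g s = f s) \<and> (\<forall>s\<ge>t. P *\<^sub>v g s = v s))"

definition input_card :: "nat \<Rightarrow> (nat \<Rightarrow> real vec) set \<Rightarrow> nat" where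
  "input_card w \<B> =
     Max {k. \<exists>P\<in>carrier_mat k w. mat_rank P = k \<and> free_components \<B> P}"

definition output_card :: "nat \<Rightarrow> (nat \<Rightarrow> real vec) set \<Rightarrow> nat" where
  "output_card w \<B> = w - input_card w \<B>"

text \<open>The partition \<open>w = (u, y)\<close> into the first \<open>input_card w \<B>\<close> and the remaining components
  is an input/output partition: \<open>u\<close> is free (and of maximal dimension). The matrix below is
  the projection \<open>(u, y) \<mapsto> u\<close>.\<close>

definition io_partitioned :: "nat \<Rightarrow> (nat \<Rightarrow> real vec) set \<Rightarrow> bool" where
  "io_partitioned w \<B> \<longleftrightarrow>
     free_components \<B> (mat (input_card w \<B>) w (\<lambda>(i, j). if i = j then 1 else 0))"

definition controllable :: "(nat \<Rightarrow> real vec) set \<Rightarrow> bool" where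
  "controllable \<B> \<longleftrightarrow>
     (\<forall>T\<ge>1. \<forall>wp\<in>restrictions 0 T \<B>. \<forall>wf\<in>\<B>.
        \<exists>T'\<ge>1. \<exists>v\<in>\<B>. restrict v {0..T} = wp \<and> (\<forall>t\<ge>T + T'. v t = wf (t - T - T')))"


section \<open>State space representations\<close>

definition ss_behavior ::
  "nat \<Rightarrow> nat \<Rightarrow> nat \<Rightarrow> real mat \<Rightarrow> real mat \<Rightarrow> real mat \<Rightarrow> real mat \<Rightarrow> (nat \<Rightarrow> real vec) set" where
  "ss_behavior n m p A B C D =
     {\<lambda>t. u t @\<^sub>v y t | u y.
        u \<in> signals m \<and> y \<in> signals p \<and>
        (\<exists>x\<in>signals n. \<forall>t. x (t + 1) = A *\<^sub>v x t + B *\<^sub>v u t \<and> y t = C *\<^sub>v x t + D *\<^sub>v u t)}"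

definition ss_rep ::
  "nat \<Rightarrow> (nat \<Rightarrow> real vec) set \<Rightarrow> nat \<Rightarrow> real mat \<Rightarrow> real mat \<Rightarrow> real mat \<Rightarrow> real mat \<Rightarrow> bool" where
  "ss_rep w \<B> n A B C D \<longleftrightarrow>
     (let m = input_card w \<B>; p = output_card w \<B> in
        A \<in> carrier_mat n n \<and> B \<in> carrier_mat n m \<and> C \<in> carrier_mat p n \<and> D \<in> carrier_mat p m \<and>
        \<B> = ss_behavior n m p A B C D)"

definition mcmillan_degree :: "nat \<Rightarrow> (nat \<Rightarrow> real vec) set \<Rightarrow> nat" where
  "mcmillan_degree w \<B> = (LEAST n. \<exists>A B C D. ss_rep w \<B> n A B C D)"

definition minimal_ss_rep ::
  "nat \<Rightarrow> (nat \<Rightarrow> real vec) set \<Rightarrow> real mat \<Rightarrow> real mat \<Rightarrow> real mat \<Rightarrow> real mat \<Rightarrow> bool" where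
  "minimal_ss_rep w \<B> A B C D \<longleftrightarrow> ss_rep w \<B> (mcmillan_degree w \<B>) A B C D"

definition observability_mat :: "nat \<Rightarrow> real mat \<Rightarrow> real mat \<Rightarrow> real mat" where
  "observability_mat L A C =
     mat (L * dim_row C) (dim_col C)
       (\<lambda>(i, j). (C * A ^\<^sub>m (i div dim_row C)) $$ (i mod dim_row C, j))"

definition lag :: "nat \<Rightarrow> (nat \<Rightarrow> real vec) set \<Rightarrow> nat" where
  "lag w \<B> = (LEAST L. \<exists>A B C D. minimal_ss_rep w \<B> A B C D \<and>
     mat_rank (observability_mat L A C) = mcmillan_degree w \<B>)"


section \<open>Relative degree of single-input single-output systems\<close>

definition has_relative_degree ::
  "real mat \<Rightarrow> real mat \<Rightarrow> real mat \<Rightarrow> real mat \<Rightarrow> enat \<Rightarrow> bool" where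
  "has_relative_degree A B C D r \<longleftrightarrow>
     (D \<noteq> 0\<^sub>m 1 1 \<and> r = 0) \<or>
     (D = 0\<^sub>m 1 1 \<and> (\<exists>q\<ge>1. r = enat q \<and>
        (\<forall>k<q - 1. C * A ^\<^sub>m k * B = 0\<^sub>m 1 1) \<and> C * A ^\<^sub>m (q - 1) * B \<noteq> 0\<^sub>m 1 1)) \<or>
     (D = 0\<^sub>m 1 1 \<and> (\<forall>k. C * A ^\<^sub>m k * B = 0\<^sub>m 1 1) \<and> r = \<infinity>)"

definition relative_degree :: "nat \<Rightarrow> (nat \<Rightarrow> real vec) set \<Rightarrow> enat" where
  "relative_degree w \<B> =
     (THE r. \<exists>n A B C D. ss_rep w \<B> n A B C D \<and> has_relative_degree A B C D r)"


section \<open>Hankel matrices\<close>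

text \<open>\<open>f\<close> is an \<open>\<real>\<^sup>k\<close>-valued signal on \<open>{0..T}\<close>. Scalar row \<open>i\<close> (counted from 0) is
  component \<open>i mod k\<close> of block row \<open>i div k\<close>; only meant for \<open>L \<le> T + 1\<close>.\<close>

definition hankel :: "nat \<Rightarrow> nat \<Rightarrow> nat \<Rightarrow> (nat \<Rightarrow> real vec) \<Rightarrow> real mat" where
  "hankel k T L f = mat (L * k) (T + 2 - L) (\<lambda>(i, j). f (i div k + j) $ (i mod k))"

definition persistently_exciting :: "nat \<Rightarrow> nat \<Rightarrow> nat \<Rightarrow> (nat \<Rightarrow> real vec) \<Rightarrow> bool" where
  "persistently_exciting k T L f \<longleftrightarrow> L \<le> T + 1 \<and> mat_rank (hankel k T L f) = L * k"

end

theory Submission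
  imports Defs "HOL-Computational_Algebra.Polynomial_Factorial"
    "HOL-Computational_Algebra.Field_as_Ring"
begin

text \<open>Let \<open>l\<close> be the first time at which zero past data and a zero input force a zero output.
  Then \<open>\<B>\<close> is the solution set of a single difference equation \<open>a(\<sigma>) y = b(\<sigma>) u\<close> with \<open>a\<close> monic of
  degree \<open>l\<close> and \<open>deg b \<le> l\<close>, and the data on \<open>{0..<l}\<close> are arbitrary; hence the McMillan degree and
  the lag are both \<open>l\<close>. Controllability makes \<open>a\<close> and \<open>b\<close> coprime. If \<open>(p, q)\<close> with
  \<open>deg q < l\<close> annihilates the data windows, then \<open>a p + b q\<close> annihilates the input, so it vanishes
  by persistency of excitation, and coprimality forces \<open>p = q = 0\<close>.
  Dividing \<open>\<sigma>\<^sup>l\<^sup>+\<^sup>k\<close> by \<open>a\<close> writes \<open>y(t + l + k)\<close> through the first \<open>l\<close> data of the window and the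
  inputs \<open>u(t + l), \<dots>, u(t + l + k)\<close>, whose coefficients are the Markov parameters
  \<open>h\<^sub>k, \<dots>, h\<^sub>0\<close>. By the uniqueness just shown, row \<open>l + k + 1\<close> of the output Hankel matrix lies in
  the span of the first \<open>l\<close> input and output rows iff \<open>h\<^sub>0 = \<dots> = h\<^sub>k = 0\<close>.\<close>

section \<open>Matrices of full row rank\<close>

context vec_space begin

lemma rank_le_nr:
  assumes "M \<in> carrier_mat n nc"
  shows "rank M \<le> n"
proof -
  obtain S where S: "maximal S (\<lambda>T. T \<subseteq> set (cols M) \<and> lin_indpt T)"
    using maximal_exists_superset[of "set (cols M)" "\<lambda>T. T \<subseteq> set (cols M) \<and> lin_indpt T" "{}"]
    by (metis List.finite_set empty_subsetI finite_lin_indpt2 finite.emptyI empty_iff)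
  then have "S \<subseteq> carrier_vec n" "lin_indpt S"
    using cols_dim[of M] assms by (auto simp: maximal_def)
  then show ?thesis
    using li_le_dim(2)[OF fin_dim] dim_is_n rank_card_indpt[OF assms S] by auto
qed

text \<open>A maximal independent set of columns has \<open>n\<close> elements, hence is already a
  basis of the whole space.\<close>

lemma full_row_rank_col_space:
  assumes "M \<in> carrier_mat n nc" and "rank M = n"
  shows "col_space M = carrier_vec n"
proof -
  obtain S where S: "maximal S (\<lambda>T. T \<subseteq> set (cols M) \<and> lin_indpt T)"
    using maximal_exists_superset[of "set (cols M)" "\<lambda>T. T \<subseteq> set (cols M) \<and> lin_indpt T" "{}"]
    by (metis List.finite_set empty_subsetI finite_lin_indpt2 finite.emptyI empty_iff)
  then have SM: "S \<subseteq> set (cols M)" and S': "S \<subseteq> carrier_vec n" "lin_indpt S"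
    using cols_dim[of M] assms by (auto simp: maximal_def)
  have "card S = n"
    using rank_card_indpt[OF assms(1) S] assms(2) by simp
  then have "basis S"
    using dim_li_is_basis[OF fin_dim _ _ S'(2)] S' SM dim_is_n finite_subset[OF SM] by auto
  then have "span S = carrier_vec n"
    by (simp add: basis_def)
  moreover have "span S \<subseteq> span (set (cols M))"
    by (rule span_is_monotone[OF SM])
  moreover have "span (set (cols M)) \<subseteq> carrier_vec n"
    using cols_dim[of M] assms by (intro span_is_subset2) auto
  ultimately show ?thesis
    by (auto simp: col_space_def)
qed

lemma col_space_full_rank:
  assumes "M \<in> carrier_mat n nc" and "col_space M = carrier_vec n"
  shows "rank M = n"
proof -
  \<comment> \<open>\<open>rank\<close> is the dimension of the column span as a space of its own;
    for a full span this space is \<open>V\<close> itself.\<close>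
  have V: "vs (carrier_vec n) = V"
    by (simp add: module_vec_def)
  have "span (set (cols M)) = carrier_vec n"
    using assms(2) by (simp add: col_space_def)
  then show ?thesis
    unfolding rank_def by (simp only: V dim_is_n)
qed

text \<open>Every unit vector is some \<open>M x\<close>, so each entry of \<open>c\<close> is
  \<open>c \<bullet> (M x)\<close>; moving \<open>M\<close> to the other side leaves a product with
  zero.\<close>

lemma full_row_rank_left_kernel:
  fixes c :: "'a vec"
  assumes "M \<in> carrier_mat n nc" and "rank M = n" and "c \<in> carrier_vec n"
    and "\<And>j. j < nc \<Longrightarrow> c \<bullet> col M j = 0"
  shows "c = 0\<^sub>v n"
proof (rule eq_vecI)
  fix i assume "i < dim_vec (0\<^sub>v n :: 'a vec)"
  then have i: "i < n" by simp
  have "unit_vec n i \<in> col_space M"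
    by (simp add: full_row_rank_col_space[OF assms(1,2)])
  then obtain x where x: "x \<in> carrier_vec nc" "M *\<^sub>v x = unit_vec n i"
    unfolding col_space_eq[OF assms(1)] using assms(1) by auto
  have "c $ i = c \<bullet> (M *\<^sub>v x)"
    using i assms(3) by (simp add: x)
  also have "\<dots> = (M\<^sup>T *\<^sub>v c) \<bullet> x"
    using assms(1,3) x(1) by (simp add: transpose_vec_mult_scalar)
  also have "M\<^sup>T *\<^sub>v c = 0\<^sub>v nc"
    using assms by (intro eq_vecI) (auto simp: comm_scalar_prod[of "col M _" n c])
  finally show "c $ i = 0\<^sub>v n $ i"
    using x(1) i by simp
qed (use assms in auto)

end

section \<open>Hankel matrices of scalar signals and spans of their rows\<close>

lemma hankel_scalar_index:
  assumes "i < L" and "j < T + 2 - L"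
  shows "hankel 1 T L f $$ (i, j) = f (i + j) $ 0"
  using assms by (simp add: hankel_def)

lemma hankel_scalar_carrier: "hankel 1 T L f \<in> carrier_mat L (T + 2 - L)"
  by (simp add: hankel_def)

text \<open>The rank condition read as independence of the Hankel rows: no nonzero difference
  operator with \<open>L\<close> coefficients annihilates all data windows.\<close>

lemma persistently_exciting_scalarD:
  fixes c :: "nat \<Rightarrow> real"
  assumes "persistently_exciting 1 T L f"
    and "\<And>j. j < T + 2 - L \<Longrightarrow> (\<Sum>i<L. c i * f (i + j) $ 0) = 0"
    and "i < L"
  shows "c i = 0"
proof -
  let ?H = "hankel 1 T L f"
  have H: "?H \<in> carrier_mat L (T + 2 - L)" by (rule hankel_scalar_carrier)
  have "vec_space.rank L ?H = L"
    using assms(1) H by (auto simp: persistently_exciting_def)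
  moreover have "vec L c \<bullet> col ?H j = 0" if "j < T + 2 - L" for j
    using assms(2)[OF that] that H hankel_scalar_index[of _ L j T f]
    by (simp add: scalar_prod_def atLeast0LessThan)
  ultimately have "vec L c = 0\<^sub>v L"
    using vec_space.full_row_rank_left_kernel[OF H] by auto
  then show ?thesis
    using assms(3) by (metis index_vec index_zero_vec(1))
qed

lemma sum_lessThan_add:
  fixes f :: "nat \<Rightarrow> 'a::comm_monoid_add"
  shows "(\<Sum>i<a + b. f i) = (\<Sum>i<a. f i) + (\<Sum>i<b. f (a + i))"
  by (induction b) (simp_all add: add.assoc)

text \<open>Turns the image condition into scalar coefficients \<open>p\<close>, \<open>q\<close>
  indexed from 0, which later serve as polynomial coefficients.\<close>

lemma mat_im_row_ranges:
  assumes "dim_col M = N" and "dim_col M' = N" and "v \<in> carrier_vec N"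
  shows "v \<in> mat_im (row_range M 1 l @\<^sub>r row_range M' 1 l)\<^sup>T \<longleftrightarrow>
    (\<exists>p q. \<forall>j<N. v $ j = (\<Sum>i<l. p i * M $$ (i, j)) + (\<Sum>i<l. q i * M' $$ (i, j)))"
    (is "v \<in> mat_im ?R \<longleftrightarrow> ?rhs")
proof -
  have R: "?R \<in> carrier_mat N (l + l)"
    using assms by (auto simp: row_range_def append_rows_def)
  have mult: "(?R *\<^sub>v x) $ j =
      (\<Sum>i<l. x $ i * M $$ (i, j)) + (\<Sum>i<l. x $ (l + i) * M' $$ (i, j))"
    if "x \<in> carrier_vec (l + l)" "j < N" for x j
  proof -
    have "(?R *\<^sub>v x) $ j = (\<Sum>i<l+l. ?R $$ (j, i) * x $ i)"
      using that R by (auto simp: scalar_prod_def atLeast0LessThan)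
    also have "\<dots> = (\<Sum>i<l. ?R $$ (j, i) * x $ i) + (\<Sum>i<l. ?R $$ (j, l + i) * x $ (l + i))"
      by (rule sum_lessThan_add)
    also have "(\<Sum>i<l. ?R $$ (j, i) * x $ i) = (\<Sum>i<l. x $ i * M $$ (i, j))"
      using that assms by (intro sum.cong) (auto simp: row_range_def append_rows_def)
    also have "(\<Sum>i<l. ?R $$ (j, l + i) * x $ (l + i)) = (\<Sum>i<l. x $ (l + i) * M' $$ (i, j))"
      using that assms by (intro sum.cong) (auto simp: row_range_def append_rows_def)
    finally show ?thesis .
  qed
  have "v \<in> mat_im ?R \<longleftrightarrow> (\<exists>x\<in>carrier_vec (l + l). ?R *\<^sub>v x = v)"
    using R assms vec_space.col_space_eq[OF R] by (auto simp del: index_transpose_mat)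
  also have "\<dots> \<longleftrightarrow> ?rhs"
  proof
    assume "\<exists>x\<in>carrier_vec (l + l). ?R *\<^sub>v x = v"
    then obtain x where "x \<in> carrier_vec (l + l)" "?R *\<^sub>v x = v" by blast
    then show ?rhs
      using mult by (intro exI[of _ "\<lambda>i. x $ i"] exI[of _ "\<lambda>i. x $ (l + i)"]) auto
  next
    assume ?rhs
    then obtain p q where pq:
      "\<forall>j<N. v $ j = (\<Sum>i<l. p i * M $$ (i, j)) + (\<Sum>i<l. q i * M' $$ (i, j))" by blast
    let ?x = "vec (l + l) (\<lambda>i. if i < l then p i else q (i - l))"
    have "?R *\<^sub>v ?x = v"
    proof (rule eq_vecI)
      show "dim_vec (?R *\<^sub>v ?x) = dim_vec v"
        using R assms by auto
      fix i assume "i < dim_vec v"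
      then have i: "i < N" using assms(3) by auto
      show "(?R *\<^sub>v ?x) $ i = v $ i"
        unfolding mult[OF vec_carrier i] using pq i by simp
    qed
    then show "\<exists>x\<in>carrier_vec (l + l). ?R *\<^sub>v x = v"
      by (intro bexI[of _ ?x]) auto
  qed
  finally show ?thesis .
qed

section \<open>Polynomials in the shift operator\<close>

text \<open>This is \<open>p(\<sigma>) f\<close> evaluated at time \<open>t\<close>, for the shift
  \<sigma> on scalar signals.\<close>

definition shift_poly :: "real poly \<Rightarrow> (nat \<Rightarrow> real) \<Rightarrow> nat \<Rightarrow> real" where
  "shift_poly p f t = (\<Sum>i\<le>degree p. coeff p i * f (t + i))"

lemma shift_poly_eq_sum:
  assumes "degree p \<le> k"
  shows "shift_poly p f t = (\<Sum>i\<le>k. coeff p i * f (t + i))"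
  unfolding shift_poly_def using assms
  by (intro sum.mono_neutral_left) (auto simp: coeff_eq_0)

text \<open>Bounding coefficients instead of the degree covers the zero polynomial with
  \<open>k = 0\<close>, which arises for systems of order 0.\<close>

lemma shift_poly_eq_sum_less:
  assumes "\<And>i. k \<le> i \<Longrightarrow> coeff p i = 0"
  shows "shift_poly p f t = (\<Sum>i<k. coeff p i * f (t + i))"
  unfolding shift_poly_def using assms
  by (intro sum.mono_neutral_cong) (auto simp: coeff_eq_0 not_less)

lemma shift_poly_cong:
  assumes "\<And>i. i \<le> degree p \<Longrightarrow> f (t + i) = g (t + i)"
  shows "shift_poly p f t = shift_poly p g t"
  using assms by (simp add: shift_poly_def)

lemma shift_poly_0 [simp]: "shift_poly 0 f t = 0"
  by (simp add: shift_poly_def)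

lemma shift_poly_eq_0:
  assumes "\<And>i. i \<le> degree p \<Longrightarrow> f (t + i) = 0"
  shows "shift_poly p f t = 0"
  using assms by (simp add: shift_poly_def)

lemma shift_poly_fun_0 [simp]: "shift_poly p (\<lambda>_. 0) t = 0"
  by (simp add: shift_poly_def)

lemma shift_poly_add: "shift_poly (p + q) f t = shift_poly p f t + shift_poly q f t"
proof -
  let ?k = "max (degree p) (degree q)"
  have "shift_poly r f t = (\<Sum>i\<le>?k. coeff r i * f (t + i))" if "r \<in> {p, q, p + q}" for r
    using that degree_add_le_max[of p q] by (intro shift_poly_eq_sum) auto
  then show ?thesis
    by (simp add: sum.distrib algebra_simps)
qed

lemma shift_poly_smult: "shift_poly (Polynomial.smult c p) f t = c * shift_poly p f t"
  by (simp add: shift_poly_eq_sum[OF degree_smult_le] shift_poly_def sum_distrib_left mult.assoc)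

lemma shift_poly_diff: "shift_poly (p - q) f t = shift_poly p f t - shift_poly q f t"
  using shift_poly_add[of "p - q" q f t] by simp

lemma shift_poly_monom: "shift_poly (monom c k) f t = c * f (t + k)"
  by (simp add: shift_poly_eq_sum[OF degree_monom_le] if_distrib[of "\<lambda>x. x * _"] cong: if_cong)

lemma shift_poly_sum: "shift_poly (\<Sum>i\<in>I. p i) f t = (\<Sum>i\<in>I. shift_poly (p i) f t)"
  by (induction I rule: infinite_finite_induct) (auto simp: shift_poly_add)

lemma shift_poly_pCons: "shift_poly (pCons c p) f t = c * f t + shift_poly p f (Suc t)"
  by (simp add: shift_poly_eq_sum[OF degree_pCons_le] sum.atMost_Suc_shift shift_poly_def
      del: sum.atMost_Suc)

lemma shift_poly_fun_add: "shift_poly p (\<lambda>t. f t + g t) t = shift_poly p f t + shift_poly p g t"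
  by (simp add: shift_poly_def sum.distrib algebra_simps)

lemma shift_poly_fun_diff: "shift_poly p (\<lambda>t. f t - g t) t = shift_poly p f t - shift_poly p g t"
  using shift_poly_fun_add[of p "\<lambda>t. f t - g t" g t] by simp

lemma shift_poly_fun_shift: "shift_poly p (\<lambda>t. f (t + k)) t = shift_poly p f (t + k)"
  by (simp add: shift_poly_def add_ac)

text \<open>Products of polynomials act as compositions of operators; this lets division and
  coprimality of polynomials be applied to signals.\<close>

lemma shift_poly_mult: "shift_poly (p * q) f t = shift_poly p (shift_poly q f) t"
proof (induction p arbitrary: t)
  case (pCons c p)
  have "shift_poly (pCons c p * q) f t = shift_poly (Polynomial.smult c q + pCons 0 (p * q)) f t"
    by simp
  then show ?case
    by (simp only: shift_poly_add shift_poly_smult shift_poly_pCons pCons.IH mult_zero_left add_0)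
qed simp

text \<open>The leading coefficient is nonzero, so the equation at \<open>s\<close> determines the
  value at \<open>s + degree a\<close> from the preceding ones.\<close>

lemma shift_poly_unique:
  assumes "a \<noteq> 0"
    and "\<And>t. t + degree a < N \<Longrightarrow> shift_poly a f t = shift_poly a g t"
    and "\<And>t. t < degree a \<Longrightarrow> f t = g t"
    and "t < N"
  shows "f t = g t"
  using \<open>t < N\<close>
proof (induction t rule: less_induct)
  case (less t)
  show ?case
  proof (cases "t < degree a")
    case False
    then obtain s where s: "t = s + degree a"
      by (metis add.commute le_add_diff_inverse linorder_not_le)
    have "(\<Sum>i<degree a. coeff a i * f (s + i)) = (\<Sum>i<degree a. coeff a i * g (s + i))"
      using less s by (intro sum.cong) auto
    moreover have "shift_poly a f s = shift_poly a g s"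
      using assms(2) less.prems s by simp
    ultimately show ?thesis
      using assms(1) by (simp add: shift_poly_def s lessThan_Suc_atMost[symmetric])
  qed (use assms in blast)
qed

section \<open>Kernel representations\<close>

text \<open>The difference equation \<open>a(\<sigma>) y = b(\<sigma>) u\<close> of order
  \<open>degree a\<close>. The degree bound on \<open>b\<close> expresses that the output does not
  anticipate the input, and \<open>initial\<close> that input and first outputs can be prescribed
  together.\<close>

locale siso_kernel =
  fixes a b :: "real poly" and W :: "(nat \<Rightarrow> real) \<Rightarrow> (nat \<Rightarrow> real) \<Rightarrow> bool"
  assumes monic: "lead_coeff a = 1"
    and degree_le: "degree b \<le> degree a"
    and kernel: "W u y \<longleftrightarrow> (\<forall>t. shift_poly a y t = shift_poly b u t)"
    and initial: "\<exists>y. W u y \<and> (\<forall>s<degree a. y s = y\<^sub>0 s)"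
begin

abbreviation l :: nat where "l \<equiv> degree a"

lemma a_nonzero: "a \<noteq> 0"
  using monic by auto

lemma output_unique:
  assumes "W u y" and "W u y'" and "\<And>s. s < l \<Longrightarrow> y s = y' s"
  shows "y t = y' t"
proof (rule shift_poly_unique[OF a_nonzero])
  show "shift_poly a y s = shift_poly a y' s" for s
    using assms(1,2) by (simp add: kernel)
qed (use assms(3) in auto)

text \<open>Zeros may be prepended because every window that begins among them sees at most the
  first \<open>l\<close> values of the old signals, which vanish.\<close>

lemma delay:
  assumes "W u y" and "\<And>s. s < l \<Longrightarrow> u s = 0" and "\<And>s. s < l \<Longrightarrow> y s = 0"
  shows "W (\<lambda>t. if t < m then 0 else u (t - m)) (\<lambda>t. if t < m then 0 else y (t - m))"
    (is "W ?u ?y")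
proof -
  have "shift_poly a ?y t = shift_poly b ?u t" for t
  proof (cases "t < m")
    case True
    have "shift_poly a ?y t = 0" "shift_poly b ?u t = 0"
      using True assms(2,3) degree_le by (auto intro!: shift_poly_eq_0)
    then show ?thesis by simp
  next
    case False
    have "shift_poly a ?y t = shift_poly a y (t - m)" "shift_poly b ?u t = shift_poly b u (t - m)"
      using False by (auto simp: shift_poly_def intro!: sum.cong)
    then show ?thesis using assms(1) by (simp add: kernel)
  qed
  then show ?thesis by (simp add: kernel)
qed

text \<open>A common factor \<open>d\<close> of \<open>a = d a'\<close> and \<open>b = d b'\<close> would give the autonomous part
  \<open>z = a' y - b' u\<close> with \<open>d z = 0\<close>, which stays zero once it is zero on a window; so no
  trajectory with \<open>z \<noteq> 0\<close> could be reached from zero.\<close>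

lemma reachable_imp_coprime:
  assumes reach: "\<And>u y. W u y \<Longrightarrow> \<exists>k v z. W v z \<and> (\<forall>s<l. v s = 0 \<and> z s = 0) \<and>
      (\<forall>t. v (k + t) = u t \<and> z (k + t) = y t)"
  shows "coprime a b"
proof -
  define d where "d = gcd a b"
  have "d \<noteq> 0" using a_nonzero by (simp add: d_def)
  obtain a' b' where ab: "a = a' * d" "b = b' * d" "coprime a' b'"
    using gcd_coprime_exists[of a b] \<open>d \<noteq> 0\<close> unfolding d_def by blast
  have "a' \<noteq> 0"
    using ab(1) a_nonzero by (metis mult_zero_left)
  have l: "l = degree a' + degree d"
    using degree_mult_eq[OF \<open>a' \<noteq> 0\<close> \<open>d \<noteq> 0\<close>] by (simp only: ab(1)[symmetric])
  have deg_b': "degree b' \<le> degree a'"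
  proof (cases "b' = 0")
    case False
    then have "degree b = degree b' + degree d"
      using degree_mult_eq[OF False \<open>d \<noteq> 0\<close>] by (simp only: ab(2)[symmetric])
    with degree_le l show ?thesis by simp
  qed simp
  have "degree d = 0"
  proof (rule ccontr)
    assume "degree d \<noteq> 0"
    \<comment> \<open>The index \<open>degree a'\<close> is below \<open>l\<close> since
      \<open>d\<close> is not constant. The single 1 there makes \<open>a'(\<sigma>) y\<close> at
      time 0 equal to the leading coefficient of \<open>a'\<close>.\<close>
    obtain y where y: "W (\<lambda>_. 0) y" "\<forall>s<l. y s = (if s = degree a' then 1 else 0)"
      using initial[of "\<lambda>_. 0" "\<lambda>s. if s = degree a' then 1 else 0"] by blast
    obtain k v z where vz: "W v z" "\<And>s. s < l \<Longrightarrow> v s = 0" "\<And>s. s < l \<Longrightarrow> z s = 0"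
      "\<And>t. v (k + t) = 0" "\<And>t. z (k + t) = y t"
      using reach[OF y(1)] by blast
    define e where "e = (\<lambda>t. shift_poly a' z t - shift_poly b' v t)"
    have "shift_poly d e t = 0" for t
    proof -
      have "shift_poly d e t = shift_poly (d * a') z t - shift_poly (d * b') v t"
        by (simp add: e_def shift_poly_fun_diff shift_poly_mult)
      also have "\<dots> = 0"
        using vz(1) by (simp add: kernel mult.commute[of d] flip: ab(1,2))
      finally show ?thesis .
    qed
    \<comment> \<open>For these \<open>t\<close> the windows of \<open>a'\<close> and
      \<open>b'\<close> stay inside the zero past, of length
      \<open>l = degree a' + degree d\<close>.\<close>
    moreover have "e t = 0" if "t < degree d" for t
    proof -
      have "shift_poly a' z t = 0" "shift_poly b' v t = 0"
        using that vz(2,3) l deg_b' by (auto intro!: shift_poly_eq_0)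
      then show ?thesis by (simp add: e_def)
    qed
    ultimately have "e k = 0"
      using shift_poly_unique[OF \<open>d \<noteq> 0\<close>, of "Suc k" e "\<lambda>_. 0" k] by simp
    moreover have "e k = (\<Sum>i\<le>degree a'. coeff a' i * y i)"
      using vz(4,5) by (simp add: e_def shift_poly_def)
    moreover have "\<dots> = (\<Sum>i\<le>degree a'. if i = degree a' then lead_coeff a' else 0)"
      using y(2) l \<open>degree d \<noteq> 0\<close> by (intro sum.cong) auto
    ultimately show False using \<open>a' \<noteq> 0\<close> by simp
  qed
  then have "is_unit d"
    using \<open>d \<noteq> 0\<close> by (simp add: is_unit_iff_degree)
  then show ?thesis
    by (simp add: d_def coprime_iff_gcd_eq_1)
qed

text \<open>Applying \<open>a(\<sigma>)\<close> to \<open>p(\<sigma>) u + q(\<sigma>) y\<close>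
  replaces \<open>a(\<sigma>) y\<close> by \<open>b(\<sigma>) u\<close> and so eliminates the
  output. This consumes \<open>l\<close> window positions, hence \<open>M + l\<close> in
  \<open>zero\<close> against \<open>M\<close> in \<open>pe\<close>.\<close>

lemma annihilator_zero:
  assumes "coprime a b" and "W u y" and "l \<le> L"
    and pe: "\<And>c. (\<And>j. j < M \<Longrightarrow> (\<Sum>i<L + l. c i * u (i + j)) = 0) \<Longrightarrow> \<forall>i<L + l. c i = 0"
    and p: "\<And>i. L \<le> i \<Longrightarrow> coeff p i = 0" and q: "\<And>i. l \<le> i \<Longrightarrow> coeff q i = 0"
    and zero: "\<And>t. t < M + l \<Longrightarrow> shift_poly p u t + shift_poly q y t = 0"
  shows "p = 0" and "q = 0"
proof -
  define g where "g = a * p + q * b"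
  have ap: "coeff (a * p) i = 0" if "L + l \<le> i" for i
    unfolding coeff_mult
  proof (intro sum.neutral ballI)
    fix j assume "j \<in> {..i}"
    then show "coeff a j * coeff p (i - j) = 0"
      using that p[of "i - j"] coeff_eq_0[of a j] by (cases "j \<le> l") auto
  qed
  have qb: "coeff (q * b) i = 0" if "L + l \<le> i" for i
    unfolding coeff_mult
  proof (intro sum.neutral ballI)
    fix j assume "j \<in> {..i}"
    then show "coeff q j * coeff b (i - j) = 0"
      using that q[of j] coeff_eq_0[of b "i - j"] degree_le \<open>l \<le> L\<close> by (cases "l \<le> j") auto
  qed
  have g_high: "coeff g i = 0" if "L + l \<le> i" for i
    using that ap qb by (simp add: g_def)
  have "shift_poly g u j = 0" if "j < M" for j
  proof -
    have "shift_poly b u = shift_poly a y"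
      using assms(2) by (auto simp: kernel)
    then have "shift_poly (q * b) u j = shift_poly (q * a) y j"
      by (simp add: shift_poly_mult)
    then have "shift_poly g u j = shift_poly a (\<lambda>t. shift_poly p u t + shift_poly q y t) j"
      by (simp add: g_def shift_poly_add shift_poly_mult shift_poly_fun_add mult.commute[of q a])
    also have "\<dots> = shift_poly a (\<lambda>_. 0) j"
      using zero that by (intro shift_poly_cong) simp
    finally show ?thesis by simp
  qed
  then have "\<forall>i<L + l. coeff g i = 0"
    using g_high by (intro pe) (simp add: shift_poly_eq_sum_less[of "L + l"] add.commute)
  then have g0: "g = 0"
    using g_high by (intro poly_eqI) (metis coeff_0 not_le)
  then have "a * p = - (q * b)"
    by (simp add: g_def eq_neg_iff_add_eq_0)
  \<comment> \<open>Coprimality moves the divisibility to \<open>q\<close>, whose degree is too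
    small for a nonzero multiple of \<open>a\<close>.\<close>
  then have "a dvd q * b"
    by (metis dvd_minus_iff dvd_triv_left)
  then have "a dvd q"
    using assms(1) by (simp add: coprime_dvd_mult_left_iff)
  show "q = 0"
  proof (rule ccontr)
    assume "q \<noteq> 0"
    then have "l \<le> degree q"
      using \<open>a dvd q\<close> by (rule dvd_imp_degree_le[rotated])
    with q[of "degree q"] \<open>q \<noteq> 0\<close> show False by simp
  qed
  then show "p = 0"
    using g0 a_nonzero by (simp add: g_def)
qed

end

section \<open>Impulse response, output prediction and the span condition\<close>

locale siso_impulse = siso_kernel +
  fixes g :: "nat \<Rightarrow> real"
  assumes impulse: "W (\<lambda>t. if t = l then 1 else 0) g"
    and rest: "s < l \<Longrightarrow> g s = 0"
begin

text \<open>The Markov parameters. The impulse acts at time \<open>l\<close>, so that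
  \<open>l\<close> zero data precede it and put the system at rest.\<close>

definition h :: "nat \<Rightarrow> real" where "h k = g (l + k)"

text \<open>From time \<open>l + 1\<close> on the impulse is past and \<open>g\<close> solves the
  homogeneous equation, so the \<open>l\<close> zeros \<open>h 1\<close>, ..., \<open>h l\<close>
  force all later ones. With \<open>h 0\<close> this makes \<open>l + 1\<close> conditions.\<close>

lemma h_eventually_zero:
  assumes "\<And>k. k < l + 1 \<Longrightarrow> h k = 0"
  shows "h k = 0"
proof (cases k)
  case (Suc k')
  have "shift_poly a (\<lambda>t. g (l + 1 + t)) t = shift_poly a (\<lambda>_. 0) t" for t
  proof -
    have "shift_poly a (\<lambda>t. g (l + 1 + t)) t = shift_poly a g (t + (l + 1))"
      using shift_poly_fun_shift[of a g "l + 1" t] by (simp add: add_ac)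
    also have "\<dots> = shift_poly b (\<lambda>t. if t = l then 1 else 0) (t + (l + 1))"
      using impulse by (simp add: kernel)
    also have "\<dots> = 0" by (simp add: shift_poly_def)
    finally show ?thesis by simp
  qed
  moreover have "g (l + 1 + t) = 0" if "t < l" for t
    using assms[of "Suc t"] that by (simp add: h_def)
  ultimately have "g (l + 1 + k') = 0"
    using shift_poly_unique[OF a_nonzero, of "Suc k'" "\<lambda>t. g (l + 1 + t)" "\<lambda>_. 0" k'] by simp
  then show ?thesis using Suc by (simp add: h_def)
qed (use assms in simp)

definition quotient :: "nat \<Rightarrow> real poly" where "quotient k = monom 1 (l + k) div a"
definition remainder :: "nat \<Rightarrow> real poly" where "remainder k = monom 1 (l + k) mod a"

lemma coeff_remainder:
  assumes "l \<le> i"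
  shows "coeff (remainder k) i = 0"
proof (cases "remainder k = 0")
  case False
  then have "degree (remainder k) < l"
    unfolding remainder_def using degree_mod_less[OF a_nonzero] by blast
  with assms show ?thesis by (intro coeff_eq_0) simp
qed simp

text \<open>Division gives \<sigma> to the power \<open>l + k\<close> as
  \<open>quotient k * a + remainder k\<close>, and \<open>a(\<sigma>) y\<close> is replaced by
  \<open>b(\<sigma>) u\<close>.\<close>

lemma output_prediction:
  assumes "W u y"
  shows "y (t + (l + k)) = shift_poly (quotient k * b) u t + shift_poly (remainder k) y t"
proof -
  have "shift_poly b u = shift_poly a y"
    using assms by (auto simp: kernel)
  then have "shift_poly (quotient k * b) u t = shift_poly (quotient k * a) y t"
    by (simp add: shift_poly_mult)
  moreover have "y (t + (l + k)) = shift_poly (quotient k * a + remainder k) y t"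
    by (simp add: quotient_def remainder_def shift_poly_monom)
  ultimately show ?thesis by (simp only: shift_poly_add)
qed

text \<open>Read off by predicting the response to an impulse at time \<open>l + m\<close>.\<close>

lemma coeff_quotient_mult:
  "coeff (quotient k * b) (l + m) = (if m \<le> k then h (k - m) else 0)"
proof -
  let ?u = "\<lambda>t. if t < m then 0 else if t - m = l then 1 else (0::real)"
  let ?y = "\<lambda>t. if t < m then 0 else g (t - m)"
  have "W ?u ?y"
    using delay[OF impulse, of m] rest by auto
  then have "?y (0 + (l + k)) = shift_poly (quotient k * b) ?u 0 + shift_poly (remainder k) ?y 0"
    by (rule output_prediction)
  \<comment> \<open>The remainder reads the output only before time \<open>l\<close>, where the
    delayed response is still zero.\<close>
  moreover have "shift_poly (remainder k) ?y 0 = 0"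
    by (subst shift_poly_eq_sum_less[OF coeff_remainder])
      (auto intro!: sum.neutral simp: rest less_imp_diff_less)
  \<comment> \<open>The maximum makes the sum reach \<open>l + m\<close> even if that exceeds the
    degree.\<close>
  moreover have "shift_poly (quotient k * b) ?u 0 =
      (\<Sum>i\<le>max (l + m) (degree (quotient k * b)). if i = l + m then coeff (quotient k * b) i else 0)"
    unfolding shift_poly_eq_sum[OF max.cobounded2[of "degree (quotient k * b)" "l + m"]]
    by (intro sum.cong) auto
  moreover have "?y (0 + (l + k)) = (if m \<le> k then h (k - m) else 0)"
    using rest[of "l + k - m"] by (auto simp: h_def)
  ultimately show ?thesis by (simp del: add_0)
qed

text \<open>If the Markov parameters up to \<open>k\<close> vanish, \<open>quotient k * b\<close>
  has no coefficient from \<open>l\<close> on and the prediction itself is the required combination.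
  Conversely, a combination minus the prediction is an annihilator, so the two coincide and these
  coefficients vanish.\<close>

theorem output_row_in_span_iff:
  assumes "coprime a b" and "W u y" and "l + k < L"
    and pe: "\<And>c. (\<And>j. j < M \<Longrightarrow> (\<Sum>i<L + l. c i * u (i + j)) = 0) \<Longrightarrow> \<forall>i<L + l. c i = 0"
  shows "(\<exists>p q. \<forall>j<M + l. y (l + k + j) = (\<Sum>i<l. p i * u (i + j)) + (\<Sum>i<l. q i * y (i + j))) \<longleftrightarrow>
    (\<forall>m\<le>k. h m = 0)" (is "?lhs \<longleftrightarrow> ?rhs")
proof
  assume ?rhs
  then have "coeff (quotient k * b) (l + m) = 0" for m
    by (simp add: coeff_quotient_mult)
  then have low: "coeff (quotient k * b) i = 0" if "l \<le> i" for i
    using that by (metis le_Suc_ex)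
  have "y (l + k + j) = (\<Sum>i<l. coeff (quotient k * b) i * u (i + j)) +
      (\<Sum>i<l. coeff (remainder k) i * y (i + j))" for j
    using output_prediction[OF assms(2), of j k]
    by (simp add: shift_poly_eq_sum_less[OF low] shift_poly_eq_sum_less[OF coeff_remainder] add_ac)
  then show ?lhs by blast
next
  assume ?lhs
  then obtain p q where pq:
    "\<And>j. j < M + l \<Longrightarrow> y (l + k + j) = (\<Sum>i<l. p i * u (i + j)) + (\<Sum>i<l. q i * y (i + j))"
    by blast
  define P where "P = (\<Sum>i<l. monom (p i) i)"
  define Q where "Q = (\<Sum>i<l. monom (q i) i)"
  have cP: "coeff P i = (if i < l then p i else 0)" and cQ: "coeff Q i = (if i < l then q i else 0)" for i
    by (auto simp: P_def Q_def coeff_sum)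
  have "quotient k * b - P = 0"
  proof (rule annihilator_zero(1)[OF assms(1,2) _ pe])
    \<comment> \<open>Coefficient \<open>l + m\<close> of the quotient part is zero for
      \<open>m > k\<close>, and \<open>i \<ge> L > l + k\<close>.\<close>
    show "coeff (quotient k * b - P) i = 0" if "L \<le> i" for i
      using coeff_quotient_mult[of k "i - l"] that assms(3) by (simp add: cP)
    show "coeff (remainder k - Q) i = 0" if "l \<le> i" for i
      using coeff_remainder[OF that] that by (simp add: cQ)
    show "shift_poly (quotient k * b - P) u t + shift_poly (remainder k - Q) y t = 0"
      if "t < M + l" for t
    proof -
      have "shift_poly P u t + shift_poly Q y t = y (t + (l + k))"
        using pq[OF that] by (simp add: P_def Q_def shift_poly_sum shift_poly_monom add_ac)
      with output_prediction[OF assms(2), of t k] show ?thesis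
        by (simp add: shift_poly_diff)
    qed
  qed (use assms(3) in auto)
  then have "coeff (quotient k * b) (l + m) = coeff P (l + m)" for m
    by simp
  then have coeff_0: "coeff (quotient k * b) (l + m) = 0" for m
    by (simp add: cP)
  \<comment> \<open>The order is reversed: \<open>h m\<close> is the coefficient at
    \<open>l + (k - m)\<close>.\<close>
  have "h m = 0" if "m \<le> k" for m
    using coeff_quotient_mult[of k "k - m"] coeff_0[of "k - m"] that by simp
  then show ?rhs by blast
qed

end

section \<open>From an abstract behavior to its difference equation\<close>

locale siso_behavior =
  fixes W :: "(nat \<Rightarrow> real) \<Rightarrow> (nat \<Rightarrow> real) \<Rightarrow> bool"
  assumes zero: "W (\<lambda>_. 0) (\<lambda>_. 0)"
    and add: "W u y \<Longrightarrow> W u' y' \<Longrightarrow> W (\<lambda>t. u t + u' t) (\<lambda>t. y t + y' t)"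
    and scale: "W u y \<Longrightarrow> W (\<lambda>t. c * u t) (\<lambda>t. c * y t)"
    and shift: "W u y \<Longrightarrow> W (\<lambda>t. u (Suc t)) (\<lambda>t. y (Suc t))"
    and closed: "(\<And>k. \<exists>u' y'. W u' y' \<and> (\<forall>s<k. u' s = u s \<and> y' s = y s)) \<Longrightarrow> W u y"
    and free: "W u y \<Longrightarrow> \<forall>s<t. u' s = u s \<Longrightarrow> \<exists>y'. W u' y' \<and> (\<forall>s<t. y' s = y s)"
    and proper: "\<exists>u y. \<not> W u y"
begin

text \<open>By linearity, this says that the past before \<open>t\<close> and the input up to
  \<open>t\<close> do not determine the output at \<open>t\<close>.\<close>

definition undetermined :: "nat \<Rightarrow> bool" where
  "undetermined t \<longleftrightarrow>
     (\<exists>u y. W u y \<and> (\<forall>s<t. u s = 0 \<and> y s = 0) \<and> u t = 0 \<and> y t \<noteq> 0)"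

text \<open>A multiple of the witness at time \<open>t\<close> corrects the output there without
  touching earlier values.\<close>

lemma undetermined_match:
  assumes "\<And>s. s < t \<Longrightarrow> undetermined s"
  shows "\<exists>y'. W u y' \<and> (\<forall>s<t. y' s = y s)"
  using assms
proof (induction t)
  case 0
  show ?case using free[OF zero, of 0 u] by simp
next
  case (Suc t)
  have "\<exists>y'. W u y' \<and> (\<forall>s<t. y' s = y s)"
    using Suc.prems by (intro Suc.IH) simp
  then obtain y' where y': "W u y'" "\<And>s. s < t \<Longrightarrow> y' s = y s"
    by blast
  have "undetermined t"
    using Suc.prems by simp
  then obtain u0 y0 where 0: "W u0 y0" "\<And>s. s < t \<Longrightarrow> u0 s = 0" "\<And>s. s < t \<Longrightarrow> y0 s = 0"
      "u0 t = 0" "y0 t \<noteq> 0"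
    unfolding undetermined_def by blast
  define c where "c = (y t - y' t) / y0 t"
  have "W (\<lambda>s. u s + c * u0 s) (\<lambda>s. y' s + c * y0 s)"
    by (rule add[OF y'(1) scale[OF 0(1)]])
  \<comment> \<open>The correction may disturb the input after \<open>t\<close>; freeness restores
    \<open>u\<close> from there on.\<close>
  moreover have "\<forall>s<Suc t. u s = u s + c * u0 s"
    using 0(2,4) by (simp add: less_Suc_eq)
  ultimately have "\<exists>y''. W u y'' \<and> (\<forall>s<Suc t. y'' s = y' s + c * y0 s)"
    by (rule free)
  then obtain y'' where y'': "W u y''" "\<And>s. s < Suc t \<Longrightarrow> y'' s = y' s + c * y0 s"
    by blast
  have "y'' s = y s" if "s < Suc t" for s
    using that y''(2)[of s] y'(2)[of s] 0(3)[of s] 0(5) by (cases "s = t") (simp_all add: c_def)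
  with y''(1) show ?case by blast
qed

lemma linear_combination:
  assumes "\<And>i. i \<in> I \<Longrightarrow> W (u i) (y i)"
  shows "W (\<lambda>t. \<Sum>i\<in>I. c i * u i t) (\<lambda>t. \<Sum>i\<in>I. c i * y i t)"
  using assms
proof (induction I rule: infinite_finite_induct)
  case (insert j I)
  then have "W (u j) (y j)" "W (\<lambda>t. \<Sum>i\<in>I. c i * u i t) (\<lambda>t. \<Sum>i\<in>I. c i * y i t)"
    by auto
  from add[OF scale[OF this(1), of "c j"] this(2)]
  show ?case using insert.hyps by simp
qed (simp_all add: zero)

text \<open>At the order \<open>l\<close>, linearity expresses the output through the last \<open>l\<close> data and the input;
  freeness of the input gives the converse inclusion.\<close>

theorem kernel_representation: "\<exists>a b. siso_kernel a b W"
proof -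
  \<comment> \<open>Otherwise every pair of signals is matched on all initial segments, hence
    belongs to the closed behavior, against \<open>proper\<close>.\<close>
  have "\<exists>t. \<not> undetermined t"
  proof (rule ccontr)
    assume "\<not> ?thesis"
    then have und: "undetermined t" for t
      by blast
    have "W u y" for u y
    proof (rule closed)
      fix k
      obtain y' where "W u y'" "\<forall>s<k. y' s = y s"
        using undetermined_match[OF und] by blast
      then show "\<exists>u' y'. W u' y' \<and> (\<forall>s<k. u' s = u s \<and> y' s = y s)"
        by (intro exI[of _ u] exI[of _ y']) simp
    qed
    with proper show False by metis
  qed
  define l where "l = (LEAST t. \<not> undetermined t)"
  have l: "\<not> undetermined l" and below: "\<And>s. s < l \<Longrightarrow> undetermined s"
    using LeastI_ex[OF \<open>\<exists>t. \<not> undetermined t\<close>] not_less_Least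
    by (auto simp: l_def)
  have match: "\<exists>y. W u y \<and> (\<forall>s<l. y s = y\<^sub>0 s)" for u y\<^sub>0
    by (rule undetermined_match) (rule below)
  \<comment> \<open>The \<open>e i\<close> respond to unit initial outputs with zero input, the
    \<open>f i\<close> below to impulses with zero initial outputs.\<close>
  have "\<forall>i. \<exists>y. W (\<lambda>_. 0) y \<and> (\<forall>s<l. y s = (if s = i then 1 else 0))"
    by (intro allI match)
  then obtain e where e: "W (\<lambda>_. 0) (e i)" "\<forall>s<l. e i s = (if s = i then 1 else 0)" for i
    by metis
  have "\<forall>i. \<exists>y. W (\<lambda>t. if t = i then 1 else 0) y \<and> (\<forall>s<l. y s = 0)"
    by (intro allI match)
  then obtain f where f: "W (\<lambda>t. if t = i then 1 else 0) (f i)" "\<forall>s<l. f i s = 0" for i :: nat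
    by metis
  have recur: "y l = (\<Sum>i<l. e i l * y i) + (\<Sum>i\<le>l. f i l * u i)" if "W u y" for u y
  proof -
    \<comment> \<open>Subtracting the responses leaves a trajectory with zero past and zero input at
      \<open>l\<close>, so its output at \<open>l\<close> vanishes. The terms \<open>y i * 0\<close>
      are the inputs of the \<open>e i\<close>.\<close>
    define v where "v = (\<lambda>t. u t + (-1) * ((\<Sum>i<l. y i * 0) +
        (\<Sum>i\<le>l. u i * (if t = i then 1 else 0))))"
    define z where "z = (\<lambda>t. y t + (-1) * ((\<Sum>i<l. y i * e i t) + (\<Sum>i\<le>l. u i * f i t)))"
    have "W v z"
      unfolding v_def z_def
      by (rule add[OF that scale[OF add[OF linear_combination linear_combination]]]) (auto simp: e f)
    moreover have "v s = 0" if "s \<le> l" for s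
      using that by (simp add: v_def if_distrib[of "\<lambda>x. _ * x"] cong: if_cong)
    moreover have "z s = 0" if "s < l" for s
      using that e(2) f(2)
      by (simp add: z_def if_distrib[of "\<lambda>x. _ * x"] cong: if_cong)
    ultimately have "z l = 0"
      using l unfolding undetermined_def by (metis less_or_eq_imp_le order_refl)
    then show ?thesis by (simp add: z_def mult.commute)
  qed
  define a where "a = monom 1 l - (\<Sum>i<l. monom (e i l) i)"
  define b where "b = (\<Sum>i\<le>l. monom (f i l) i)"
  have ca: "coeff a i = (if i = l then 1 else if i < l then - e i l else 0)" for i
    by (simp add: a_def coeff_sum)
  have deg_a: "degree a = l"
    using ca by (intro antisym degree_le le_degree) auto
  have lead_a: "lead_coeff a = 1"
    using ca deg_a by simp
  have deg_b: "degree b \<le> degree a"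
    unfolding b_def deg_a
    by (intro degree_sum_le) (auto intro: order_trans[OF degree_monom_le])
  have eq_iff: "shift_poly a y t = shift_poly b u t \<longleftrightarrow>
      y (t + l) = (\<Sum>i<l. e i l * y (t + i)) + (\<Sum>i\<le>l. f i l * u (t + i))" for u y t
    by (auto simp: a_def b_def shift_poly_diff shift_poly_sum shift_poly_monom)
  have shifts: "W (\<lambda>s. u (s + t)) (\<lambda>s. y (s + t))" if "W u y" for u y t
    using that by (induction t) (use shift in force)+
  have kernel: "shift_poly a y t = shift_poly b u t" if "W u y" for u y t
    using recur[OF shifts[OF that, of t]] by (simp add: eq_iff add.commute)
  \<comment> \<open>Some trajectory has input \<open>u\<close> and the same first \<open>l\<close>
    outputs as \<open>y\<close>; the recursion makes it equal to \<open>y\<close>.\<close>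
  have "W u y" if "\<And>t. shift_poly a y t = shift_poly b u t" for u y
  proof -
    obtain y' where y': "W u y'" "\<forall>s<l. y' s = y s"
      using match by blast
    have "a \<noteq> 0" using lead_a by auto
    then have "y' t = y t" for t
      using shift_poly_unique[of a "Suc t" y' y t] that kernel[OF y'(1)] y'(2) deg_a
      by auto
    then show ?thesis using y'(1) by presburger
  qed
  then have "W u y \<longleftrightarrow> (\<forall>t. shift_poly a y t = shift_poly b u t)" for u y
    using kernel by blast
  moreover have "\<exists>y. W u y \<and> (\<forall>s<degree a. y s = y\<^sub>0 s)" for u y\<^sub>0
    unfolding deg_a by (rule match)
  ultimately have "siso_kernel a b W"
    using lead_a deg_b by unfold_locales
  then show ?thesis by blast
qed

end

section \<open>State space representations\<close>

definition io_signal :: "(nat \<Rightarrow> real) \<Rightarrow> (nat \<Rightarrow> real) \<Rightarrow> nat \<Rightarrow> real vec" where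
  "io_signal u y t = vec 2 (\<lambda>i. if i = 0 then u t else y t)"

lemma io_signal_index [simp]: "io_signal u y t $ 0 = u t" "io_signal u y t $ Suc 0 = y t"
  by (auto simp: io_signal_def)

lemma io_signal_in_signals: "io_signal u y \<in> signals 2"
  by (simp add: io_signal_def signals_def)

lemma io_signal_components:
  assumes "f \<in> signals 2"
  shows "io_signal (\<lambda>t. f t $ 0) (\<lambda>t. f t $ 1) = f"
proof
  fix t
  have "dim_vec (f t) = 2"
    using assms by (auto simp: signals_def)
  then show "io_signal (\<lambda>t. f t $ 0) (\<lambda>t. f t $ 1) t = f t"
    by (intro eq_vecI) (auto simp: io_signal_def less_2_cases_iff)
qed

lemma append_scalars:
  assumes "v \<in> carrier_vec 1" and "w \<in> carrier_vec 1"
  shows "v @\<^sub>v w = vec 2 (\<lambda>i. if i = 0 then v $ 0 else w $ 0)"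
  using assms by (intro eq_vecI) (auto simp: less_2_cases_iff)

definition ss_solution ::
  "nat \<Rightarrow> real mat \<Rightarrow> real mat \<Rightarrow> real mat \<Rightarrow> real mat \<Rightarrow>
    (nat \<Rightarrow> real) \<Rightarrow> (nat \<Rightarrow> real) \<Rightarrow> (nat \<Rightarrow> real vec) \<Rightarrow> bool" where
  "ss_solution n A B C D u y x \<longleftrightarrow> x \<in> signals n \<and>
     (\<forall>t. x (Suc t) = A *\<^sub>v x t + u t \<cdot>\<^sub>v col B 0 \<and> y t = row C 0 \<bullet> x t + D $$ (0, 0) * u t)"

definition siso_carriers :: "nat \<Rightarrow> real mat \<Rightarrow> real mat \<Rightarrow> real mat \<Rightarrow> real mat \<Rightarrow> bool" where
  "siso_carriers n A B C D \<longleftrightarrow>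
     A \<in> carrier_mat n n \<and> B \<in> carrier_mat n 1 \<and> C \<in> carrier_mat 1 n \<and> D \<in> carrier_mat 1 1"

lemma ss_behavior_siso_iff:
  assumes "siso_carriers n A B C D"
  shows "io_signal u y \<in> ss_behavior n 1 1 A B C D \<longleftrightarrow> (\<exists>x. ss_solution n A B C D u y x)"
proof -
  note c = assms[unfolded siso_carriers_def]
  let ?u = "\<lambda>t. vec 1 (\<lambda>_. u t)" and ?y = "\<lambda>t. vec 1 (\<lambda>_. y t)"
  have "io_signal u y \<in> ss_behavior n 1 1 A B C D \<longleftrightarrow>
      (\<exists>x\<in>signals n. \<forall>t. x (t + 1) = A *\<^sub>v x t + B *\<^sub>v ?u t \<and> ?y t = C *\<^sub>v x t + D *\<^sub>v ?u t)"
    (is "_ \<longleftrightarrow> ?rhs")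
  proof
    assume "io_signal u y \<in> ss_behavior n 1 1 A B C D"
    then obtain u' y' x where *: "io_signal u y = (\<lambda>t. u' t @\<^sub>v y' t)" "u' \<in> signals 1" "y' \<in> signals 1"
      "x \<in> signals n" "\<forall>t. x (t + 1) = A *\<^sub>v x t + B *\<^sub>v u' t \<and> y' t = C *\<^sub>v x t + D *\<^sub>v u' t"
      by (auto simp: ss_behavior_def)
    have "u' = ?u \<and> y' = ?y"
    proof -
      have "u' t $ 0 = u t \<and> y' t $ 0 = y t" for t
        using fun_cong[OF *(1), of t] *(2,3) io_signal_index[of u y t]
        by (auto simp: signals_def append_scalars)
      then show ?thesis
        using *(2,3) by (auto simp: signals_def intro!: ext eq_vecI)
    qed
    with *(4,5) show ?rhs by auto
  next
    assume ?rhs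
    moreover have "io_signal u y = (\<lambda>t. ?u t @\<^sub>v ?y t)"
      by (intro ext) (simp add: append_scalars io_signal_def cong: if_cong)
    ultimately show "io_signal u y \<in> ss_behavior n 1 1 A B C D"
      unfolding ss_behavior_def
      by (intro CollectI exI[of _ ?u] exI[of _ ?y]) (auto simp: signals_def)
  qed
  moreover have "B *\<^sub>v ?u t = u t \<cdot>\<^sub>v col B 0" for t
    using c by (intro eq_vecI) (auto simp: scalar_prod_def)
  moreover have "?y t = C *\<^sub>v x t + D *\<^sub>v ?u t \<longleftrightarrow> y t = row C 0 \<bullet> x t + D $$ (0, 0) * u t" for x t
  proof
    assume *: "?y t = C *\<^sub>v x t + D *\<^sub>v ?u t"
    have "?y t $ 0 = row C 0 \<bullet> x t + D $$ (0, 0) * u t"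
      unfolding * using c by (auto simp: scalar_prod_def)
    then show "y t = row C 0 \<bullet> x t + D $$ (0, 0) * u t" by simp
  next
    assume "y t = row C 0 \<bullet> x t + D $$ (0, 0) * u t"
    then show "?y t = C *\<^sub>v x t + D *\<^sub>v ?u t"
      using c by (intro eq_vecI) (auto simp: scalar_prod_def)
  qed
  ultimately show ?thesis
    by (auto simp: ss_solution_def)
qed

text \<open>Matrix powers unfold with the extra factor on the right, whereas the state recursion
  multiplies on the left.\<close>

lemma pow_mat_Suc_mult_vec:
  fixes A :: "'a::semiring_1 mat"
  assumes "A \<in> carrier_mat n n" and "v \<in> carrier_vec n"
  shows "A ^\<^sub>m Suc k *\<^sub>v v = A *\<^sub>v (A ^\<^sub>m k *\<^sub>v v)"
  using assms(2)
proof (induction k arbitrary: v)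
  case (Suc k)
  have pow_Suc: "A ^\<^sub>m Suc m *\<^sub>v v = A ^\<^sub>m m *\<^sub>v (A *\<^sub>v v)" for m
    using assoc_mult_mat_vec[of "A ^\<^sub>m m" n n A n v] assms(1) Suc.prems by simp
  have "A *\<^sub>v v \<in> carrier_vec n"
    using assms(1) Suc.prems by simp
  then show ?case
    using Suc.IH[of "A *\<^sub>v v"] by (simp only: pow_Suc)
qed (use assms(1) in simp)

lemma row_mult_pow_mat_vec:
  fixes A C :: "'a::semiring_1 mat"
  assumes "A \<in> carrier_mat n n" and "C \<in> carrier_mat 1 n" and "v \<in> carrier_vec n"
  shows "row C 0 \<bullet> (A ^\<^sub>m k *\<^sub>v v) = (\<Sum>j<n. (C * A ^\<^sub>m k) $$ (0, j) * v $ j)"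
proof -
  have P: "A ^\<^sub>m k \<in> carrier_mat n n" using assms(1) by simp
  have "row C 0 \<bullet> (A ^\<^sub>m k *\<^sub>v v) = (C *\<^sub>v (A ^\<^sub>m k *\<^sub>v v)) $ 0"
    using assms(2) by simp
  also have "\<dots> = ((C * A ^\<^sub>m k) *\<^sub>v v) $ 0"
    by (simp only: assoc_mult_mat_vec[OF assms(2) P assms(3)])
  also have "\<dots> = (\<Sum>j<n. (C * A ^\<^sub>m k) $$ (0, j) * v $ j)"
    using assms P by (simp add: scalar_prod_def[of "row (C * A ^\<^sub>m k) 0"] atLeast0LessThan)
  finally show ?thesis .
qed

text \<open>Evaluates products with the subdiagonal ones and the last column of the observer form
  below; \<open>i = m\<close> reads the last entry.\<close>

lemma sum_if_eq_Suc:
  fixes f :: "nat \<Rightarrow> real"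
  assumes "i \<le> m"
  shows "(\<Sum>j<m. (if i = Suc j then c else 0) * f j) = (if i = 0 then 0 else c * f (i - 1))"
  using assms by (cases i) (auto simp: if_distrib[of "\<lambda>x. x * _"] cong: if_cong)

section \<open>State dimension, observability and Markov parameters\<close>

context siso_impulse begin

definition siso_rep :: "nat \<Rightarrow> real mat \<Rightarrow> real mat \<Rightarrow> real mat \<Rightarrow> real mat \<Rightarrow> bool" where
  "siso_rep n A B C D \<longleftrightarrow>
     siso_carriers n A B C D \<and> (\<forall>u y. W u y \<longleftrightarrow> (\<exists>x. ss_solution n A B C D u y x))"

lemma observability_mat_carrier:
  assumes "siso_rep n A B C D"
  shows "observability_mat k A C \<in> carrier_mat k n"
  using assms by (auto simp: observability_mat_def siso_rep_def siso_carriers_def)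

text \<open>With zero input the first \<open>l\<close> outputs are the matrix applied to the initial
  state. Any such outputs occur, so the matrix is onto, whatever the state dimension.\<close>

lemma observability_mat_full_rank:
  assumes "siso_rep n A B C D"
  shows "mat_rank (observability_mat l A C) = l"
proof -
  let ?O = "observability_mat l A C"
  have c: "A \<in> carrier_mat n n" "B \<in> carrier_mat n 1" "C \<in> carrier_mat 1 n" "D \<in> carrier_mat 1 1"
    and W: "\<And>u y. W u y \<longleftrightarrow> (\<exists>x. ss_solution n A B C D u y x)"
    using assms by (auto simp: siso_rep_def siso_carriers_def)
  have O: "?O \<in> carrier_mat l n"
    by (rule observability_mat_carrier[OF assms])
  have "\<exists>x\<in>carrier_vec n. ?O *\<^sub>v x = v" if v: "v \<in> carrier_vec l" for v
  proof -
    obtain y where y: "W (\<lambda>_. 0) y" "\<And>s. s < l \<Longrightarrow> y s = v $ s"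
      using initial[of "\<lambda>_. 0" "\<lambda>s. v $ s"] by blast
    then obtain x where x: "x \<in> signals n" "\<And>t. x (Suc t) = A *\<^sub>v x t + 0 \<cdot>\<^sub>v col B 0"
      "\<And>t. y t = row C 0 \<bullet> x t"
      unfolding W ss_solution_def by auto
    have x_carrier: "x t \<in> carrier_vec n" for t
      using x(1) by (simp add: signals_def)
    have "x t = A ^\<^sub>m t *\<^sub>v x 0" for t
    proof (induction t)
      case 0
      then show ?case using c x_carrier by simp
    next
      case (Suc t)
      have "x (Suc t) = A *\<^sub>v x t"
        using x(2)[of t] c x_carrier by (intro eq_vecI) auto
      then show ?case
        using pow_mat_Suc_mult_vec[OF c(1) x_carrier, of t 0] Suc by simp
    qed
    then have y_eq: "y t = (\<Sum>j<n. (C * A ^\<^sub>m t) $$ (0, j) * x 0 $ j)" for t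
      by (metis x(3) row_mult_pow_mat_vec[OF c(1,3) x_carrier])
    have "?O *\<^sub>v x 0 = v"
    proof (rule eq_vecI)
      show "dim_vec (?O *\<^sub>v x 0) = dim_vec v"
        using O v by simp
      fix i assume "i < dim_vec v"
      then have i: "i < l" using v by simp
      have "dim_vec (x 0) = n"
        using x_carrier[of 0] by simp
      then have "(?O *\<^sub>v x 0) $ i = (\<Sum>j<n. ?O $$ (i, j) * x 0 $ j)"
        using O i by (simp add: scalar_prod_def atLeast0LessThan)
      also have "\<dots> = y i"
        unfolding y_eq using i c by (intro sum.cong) (simp_all add: observability_mat_def)
      finally show "(?O *\<^sub>v x 0) $ i = v $ i"
        using y(2)[OF i] by simp
    qed
    then show ?thesis using x_carrier by blast
  qed
  then have "vec_space.col_space l ?O = carrier_vec l"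
    using vec_space.col_space_eq[OF O] O by auto
  then show ?thesis
    using vec_space.col_space_full_rank[OF O] O by auto
qed

lemma siso_rep_dim_ge:
  assumes "siso_rep n A B C D"
  shows "l \<le> n"
  using observability_mat_full_rank[OF assms] observability_mat_carrier[OF assms, of l]
    vec_space.rank_le_nc[OF observability_mat_carrier[OF assms, of l]] by auto

text \<open>The output of an explicit impulse response in state space must be \<open>g\<close>,
  because the response from rest is unique.\<close>

lemma siso_rep_markov:
  assumes "siso_rep n A B C D"
  shows "D $$ (0, 0) = h 0" and "(C * A ^\<^sub>m k * B) $$ (0, 0) = h (Suc k)"
proof -
  have c: "A \<in> carrier_mat n n" "B \<in> carrier_mat n 1" "C \<in> carrier_mat 1 n" "D \<in> carrier_mat 1 1"
    and W: "\<And>u y. W u y \<longleftrightarrow> (\<exists>x. ss_solution n A B C D u y x)"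
    using assms by (auto simp: siso_rep_def siso_carriers_def)
  have colB: "col B 0 \<in> carrier_vec n"
    using c by auto
  have row_zero: "row C 0 \<bullet> 0\<^sub>v n = 0"
    by (simp add: scalar_prod_def)
  define u where "u = (\<lambda>t. if t = l then 1 else (0::real))"
  \<comment> \<open>The state is zero up to time \<open>l\<close>; the impulse at \<open>l\<close>
    loads the input column one step later.\<close>
  define x where "x = (\<lambda>t. if t \<le> l then 0\<^sub>v n else A ^\<^sub>m (t - Suc l) *\<^sub>v col B 0)"
  define y where "y = (\<lambda>t. row C 0 \<bullet> x t + D $$ (0, 0) * u t)"
  have "x (Suc t) = A *\<^sub>v x t + u t \<cdot>\<^sub>v col B 0" for t
  proof -
    consider "t < l" | "t = l" | k where "t = Suc (l + k)"
      by (metis less_iff_Suc_add linorder_neqE_nat)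
    then show ?thesis
    proof cases
      case 1
      then show ?thesis using c colB by (intro eq_vecI) (auto simp: x_def u_def)
    next
      case 2
      then show ?thesis using c colB by (intro eq_vecI) (auto simp: x_def u_def)
    next
      case 3
      then have "x (Suc t) = A ^\<^sub>m Suc k *\<^sub>v col B 0" "x t = A ^\<^sub>m k *\<^sub>v col B 0" "u t = 0"
        by (simp_all add: x_def u_def)
      then show ?thesis
        using pow_mat_Suc_mult_vec[OF c(1) colB, of k] c colB
        by (intro eq_vecI) (simp_all add: mult_mat_vec_carrier[of _ n n])
    qed
  qed
  moreover have "x \<in> signals n"
    using mult_mat_vec_carrier[OF pow_carrier_mat[OF c(1)] colB] by (simp add: signals_def x_def)
  ultimately have "W u y"
    unfolding W ss_solution_def by (intro exI[of _ x]) (auto simp: y_def)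
  moreover have "y s = 0" if "s < l" for s
    using that by (simp add: y_def x_def u_def row_zero)
  ultimately have y: "y t = g t" for t
    using output_unique[of u y g t] impulse rest by (simp add: u_def)
  show "D $$ (0, 0) = h 0"
    using y[of l] by (simp add: y_def x_def u_def h_def row_zero)
  have "h (Suc k) = row C 0 \<bullet> (A ^\<^sub>m k *\<^sub>v col B 0)"
    using y[of "l + Suc k"] by (simp add: y_def x_def u_def h_def)
  also have "\<dots> = (\<Sum>j<n. (C * A ^\<^sub>m k) $$ (0, j) * col B 0 $ j)"
    by (rule row_mult_pow_mat_vec[OF c(1,3) colB])
  also have "\<dots> = (C * A ^\<^sub>m k * B) $$ (0, 0)"
    using c by (simp add: scalar_prod_def[of "row (C * A ^\<^sub>m k) 0"] atLeast0LessThan)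
  finally show "(C * A ^\<^sub>m k * B) $$ (0, 0) = h (Suc k)" by simp
qed

text \<open>Observer canonical form, with state
  \<open>x\<^sub>k(t) = (\<Sum>i>k. a\<^sub>i y(t + i - k - 1) - b\<^sub>i u(t + i - k - 1))\<close>.\<close>

lemma siso_rep_exists: "\<exists>A B C D. siso_rep l A B C D"
proof -
  define A where "A = mat l l (\<lambda>(i, j). (if i = Suc j then 1 else 0) + (if l = Suc j then - coeff a i else 0))"
  define B where "B = mat l 1 (\<lambda>(i, j). coeff b i - coeff a i * coeff b l)"
  define C where "C = mat 1 l (\<lambda>(i, j). if l = Suc j then 1 else (0::real))"
  define D where "D = mat 1 1 (\<lambda>_. coeff b l)"
  note defs = A_def B_def C_def D_def
  \<comment> \<open>The index is shifted by one, with \<open>X x 0 = 0\<close>, so that the first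
    state equation has the same form as the others.\<close>
  define X where "X x k = (if k = 0 then 0 else (x :: real vec) $ (k - 1))" for x k
  \<comment> \<open>\<open>S\<close> collects the terms of the difference equation from index
    \<open>k\<close> on: \<open>k = 0\<close> gives the whole equation, \<open>Suc k\<close> the
    state component \<open>k\<close>.\<close>
  define S where "S u y k t = (\<Sum>i\<in>{k..l}. coeff a i * y (t + i - k) - coeff b i * u (t + i - k))"
    for u y k t
  have S_rec: "S u y k t = coeff a k * y t - coeff b k * u t + S u y (Suc k) (Suc t)" if "k \<le> l" for u y k t
    using that by (simp add: S_def sum.atLeast_Suc_atMost)
  have S_top: "S u y (Suc l) t = 0" for u y t
    by (simp add: S_def)
  have S_kernel: "W u y \<longleftrightarrow> (\<forall>t. S u y 0 t = 0)" for u y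
    by (simp add: kernel S_def sum_subtractf shift_poly_eq_sum[OF degree_le]
        shift_poly_def[of a] atMost_atLeast0)
  have row_C: "row C 0 \<bullet> x = X x l" if "x \<in> carrier_vec l" for x
    using that sum_if_eq_Suc[of l l 1 "\<lambda>j. x $ j"]
    by (simp add: C_def scalar_prod_def X_def atLeast0LessThan)
  have step: "(A *\<^sub>v x + c \<cdot>\<^sub>v col B 0) $ i =
      X x i - coeff a i * (X x l + coeff b l * c) + coeff b i * c"
    if "x \<in> carrier_vec l" "i < l" for x c i
    using that sum_if_eq_Suc[of i l 1 "\<lambda>j. x $ j"] sum_if_eq_Suc[of l l "- coeff a i" "\<lambda>j. x $ j"]
    by (simp add: A_def B_def scalar_prod_def X_def atLeast0LessThan distrib_right sum.distrib algebra_simps)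
  have solution_iff: "ss_solution l A B C D u y x \<longleftrightarrow> x \<in> signals l \<and> (\<forall>t. y t = X (x t) l + coeff b l * u t) \<and>
      (\<forall>t. \<forall>i<l. X (x (Suc t)) (Suc i) = X (x t) i - coeff a i * y t + coeff b i * u t)" for u y x
  proof -
    have "ss_solution l A B C D u y x \<longleftrightarrow> x \<in> signals l \<and> (\<forall>t. y t = X (x t) l + coeff b l * u t) \<and>
        (\<forall>t. x (Suc t) = A *\<^sub>v x t + u t \<cdot>\<^sub>v col B 0)"
      by (auto simp: ss_solution_def signals_def row_C D_def)
    also have "\<dots> \<longleftrightarrow> x \<in> signals l \<and> (\<forall>t. y t = X (x t) l + coeff b l * u t) \<and>
        (\<forall>t. \<forall>i<l. x (Suc t) $ i = X (x t) i - coeff a i * y t + coeff b i * u t)"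
    proof (intro conj_cong refl all_cong1)
      fix t assume x: "x \<in> signals l" and y: "\<forall>t. y t = X (x t) l + coeff b l * u t"
      have "dim_vec (A *\<^sub>v x t + u t \<cdot>\<^sub>v col B 0) = l" "dim_vec (x (Suc t)) = l" "x t \<in> carrier_vec l"
        using x by (auto simp: B_def signals_def)
      then show "(x (Suc t) = A *\<^sub>v x t + u t \<cdot>\<^sub>v col B 0) \<longleftrightarrow>
          (\<forall>i<l. x (Suc t) $ i = X (x t) i - coeff a i * y t + coeff b i * u t)"
        using y step[of "x t" _ "u t"] by (auto simp: vec_eq_iff)
    qed
    finally show ?thesis by (simp add: X_def)
  qed
  have "W u y \<longleftrightarrow> (\<exists>x. ss_solution l A B C D u y x)" for u y
  proof
    assume "W u y"
    define x where "x t = vec l (\<lambda>k. S u y (Suc k) t)" for t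
    have X: "X (x t) k = S u y k t" if "k \<le> l" for k t
      using that \<open>W u y\<close> S_kernel[of u y] by (cases k) (auto simp: X_def x_def)
    have "ss_solution l A B C D u y x"
      unfolding solution_iff
    proof (intro conjI allI impI)
      show "x \<in> signals l"
        by (simp add: signals_def x_def)
      show "y t = X (x t) l + coeff b l * u t" for t
        using S_rec[of l u y t] monic by (simp add: X S_top)
      show "X (x (Suc t)) (Suc i) = X (x t) i - coeff a i * y t + coeff b i * u t" if "i < l" for i t
        using that S_rec[of i u y t] by (simp add: X)
    qed
    then show "\<exists>x. ss_solution l A B C D u y x" by blast
  next
    assume "\<exists>x. ss_solution l A B C D u y x"
    then obtain x where y: "\<And>t. y t = X (x t) l + coeff b l * u t"
      and x: "\<And>t i. i < l \<Longrightarrow> X (x (Suc t)) (Suc i) = X (x t) i - coeff a i * y t + coeff b i * u t"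
      unfolding solution_iff by blast
    \<comment> \<open>Downward induction from the output equation at \<open>k = l\<close>; at
      \<open>k = 0\<close> it yields the difference equation.\<close>
    have "S u y k t = X (x t) k" if "k \<le> l" for k t
      using that
    proof (induction k arbitrary: t rule: inc_induct)
      case base
      show ?case using S_rec[of l u y t] S_top y[of t] monic by simp
    next
      case (step k)
      then show ?case using S_rec[of k u y t] x[of k t] by simp
    qed
    then show "W u y"
      by (simp add: S_kernel X_def)
  qed
  moreover have "siso_carriers l A B C D"
    by (simp add: siso_carriers_def defs)
  ultimately show ?thesis
    unfolding siso_rep_def by blast
qed

end

section \<open>Behaviors and their relative degree\<close>

lemma signals_dim:
  assumes "f \<in> signals w"
  shows "dim_vec (f t) = w"
  using assms by (auto simp: signals_def)

text \<open>In the full behavior all components are free, as the identity matrix witnesses. This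
  will exclude a full behavior with only one input.\<close>

lemma input_card_full_behavior:
  assumes "\<And>f. f \<in> signals w \<Longrightarrow> f \<in> \<B>" and "\<B> \<subseteq> signals w"
  shows "w \<le> input_card w \<B>"
proof -
  let ?K = "{k. \<exists>P\<in>carrier_mat k w. mat_rank P = k \<and> free_components \<B> P}"
  have "?K \<subseteq> {..w}"
  proof
    fix k assume "k \<in> ?K"
    then obtain P where P: "P \<in> carrier_mat k w" "mat_rank P = k" by blast
    then have "dim_row P = k" by simp
    then show "k \<in> {..w}"
      using vec_space.rank_le_nc[OF P(1)] P(2) by simp
  qed
  then have "finite ?K"
    by (rule finite_subset) simp
  moreover have "w \<in> ?K"
  proof -
    have "vec_space.rank w (1\<^sub>m w :: real mat) = w"
      by (simp add: vec_space.low_rank_det_zero)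
    moreover have "free_components \<B> (1\<^sub>m w)"
      unfolding free_components_def
    proof (intro ballI allI)
      fix f t v assume "f \<in> \<B>" and "v \<in> signals (dim_row (1\<^sub>m w :: real mat))"
      then have "(\<lambda>s. if s < t then f s else v s) \<in> \<B>" "\<And>s. v s \<in> carrier_vec w"
        using assms by (auto simp: signals_def)
      then show "\<exists>g\<in>\<B>. (\<forall>s<t. g s = f s) \<and> (\<forall>s\<ge>t. 1\<^sub>m w *\<^sub>v g s = v s)"
        by (intro bexI[of _ "\<lambda>s. if s < t then f s else v s"]) auto
    qed
    ultimately show ?thesis by (intro CollectI bexI[of _ "1\<^sub>m w"]) auto
  qed
  ultimately show ?thesis
    unfolding input_card_def by (rule Max_ge)
qed

lemma siso_behavior_io:
  assumes "\<B> \<in> behaviors 2" and "input_card 2 \<B> = 1" and "io_partitioned 2 \<B>"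
  shows "siso_behavior (\<lambda>u y. io_signal u y \<in> \<B>)"
proof
  have sub: "\<B> \<subseteq> signals 2" and zero: "(\<lambda>t. 0\<^sub>v 2) \<in> \<B>"
    and add: "\<And>f g. f \<in> \<B> \<Longrightarrow> g \<in> \<B> \<Longrightarrow> (\<lambda>t. f t + g t) \<in> \<B>"
    and scale: "\<And>c f. f \<in> \<B> \<Longrightarrow> (\<lambda>t. c \<cdot>\<^sub>v f t) \<in> \<B>"
    and shift: "\<And>f. f \<in> \<B> \<Longrightarrow> shift f \<in> \<B>"
    and closed: "pointwise_closed 2 \<B>"
    using assms(1) by (auto simp: behaviors_def linear_behavior_def)
  have "io_signal (\<lambda>_. 0) (\<lambda>_. 0) = (\<lambda>t. 0\<^sub>v 2)"
    by (auto simp: io_signal_def intro!: eq_vecI)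
  then show "io_signal (\<lambda>_. 0) (\<lambda>_. 0) \<in> \<B>"
    using zero by simp
  show "io_signal (\<lambda>t. u t + u' t) (\<lambda>t. y t + y' t) \<in> \<B>"
    if "io_signal u y \<in> \<B>" "io_signal u' y' \<in> \<B>" for u y u' y'
  proof -
    have "io_signal (\<lambda>t. u t + u' t) (\<lambda>t. y t + y' t) = (\<lambda>t. io_signal u y t + io_signal u' y' t)"
      by (auto simp: io_signal_def intro!: eq_vecI)
    then show ?thesis using add[OF that] by simp
  qed
  show "io_signal (\<lambda>t. c * u t) (\<lambda>t. c * y t) \<in> \<B>" if "io_signal u y \<in> \<B>" for u y c
  proof -
    have "io_signal (\<lambda>t. c * u t) (\<lambda>t. c * y t) = (\<lambda>t. c \<cdot>\<^sub>v io_signal u y t)"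
      by (auto simp: io_signal_def intro!: eq_vecI)
    then show ?thesis using scale[OF that] by simp
  qed
  show "io_signal (\<lambda>t. u (Suc t)) (\<lambda>t. y (Suc t)) \<in> \<B>" if "io_signal u y \<in> \<B>" for u y
  proof -
    have "io_signal (\<lambda>t. u (Suc t)) (\<lambda>t. y (Suc t)) = shift (io_signal u y)"
      by (auto simp: io_signal_def Defs.shift_def)
    then show ?thesis using shift[OF that] by simp
  qed
  show "io_signal u y \<in> \<B>"
    if approx: "\<And>k. \<exists>u' y'. io_signal u' y' \<in> \<B> \<and> (\<forall>s<k. u' s = u s \<and> y' s = y s)" for u y
  proof -
    have "\<forall>k. \<exists>F. F \<in> \<B> \<and> (\<forall>s<k. F s = io_signal u y s)"
    proof
      fix k
      obtain u' y' where "io_signal u' y' \<in> \<B>" "\<forall>s<k. u' s = u s \<and> y' s = y s"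
        using approx by blast
      then show "\<exists>F. F \<in> \<B> \<and> (\<forall>s<k. F s = io_signal u y s)"
        by (intro exI[of _ "io_signal u' y'"]) (simp add: io_signal_def cong: if_cong)
    qed
    then obtain F where F: "\<forall>k. F k \<in> \<B>" "\<And>k s. s < k \<Longrightarrow> F k s = io_signal u y s"
      by metis
    \<comment> \<open>At a fixed time the sequence is constant for \<open>k > t\<close>, so
      agreement on initial segments gives pointwise convergence.\<close>
    have "(\<lambda>k. F k t $ i) \<longlonglongrightarrow> io_signal u y t $ i" for t i
      by (rule tendsto_eventually, rule eventually_sequentiallyI[of "Suc t"]) (simp add: F(2))
    then show ?thesis
      using closed F(1) io_signal_in_signals[of u y] unfolding pointwise_closed_def by blast
  qed
  show "\<exists>y'. io_signal u' y' \<in> \<B> \<and> (\<forall>s<t. y' s = y s)"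
    if "io_signal u y \<in> \<B>" and eq: "\<forall>s<t. u' s = u s" for u y t u'
  proof -
    let ?P = "mat 1 2 (\<lambda>(i, j). if i = j then 1 else 0) :: real mat"
    have free: "free_components \<B> ?P"
      using assms(2,3) by (simp add: io_partitioned_def)
    have v: "(\<lambda>s. vec 1 (\<lambda>_. u' s)) \<in> signals (dim_row ?P)"
      by (simp add: signals_def)
    have "\<exists>g\<in>\<B>. (\<forall>s<t. g s = io_signal u y s) \<and> (\<forall>s\<ge>t. ?P *\<^sub>v g s = vec 1 (\<lambda>_. u' s))"
      by (rule free[unfolded free_components_def, THEN bspec, THEN spec, THEN bspec, OF that(1) v])
    then obtain g where g: "g \<in> \<B>" "\<And>s. s < t \<Longrightarrow> g s = io_signal u y s"
      "\<And>s. t \<le> s \<Longrightarrow> ?P *\<^sub>v g s = vec 1 (\<lambda>_. u' s)"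
      by blast
    have g_signal: "g \<in> signals 2"
      using g(1) sub by blast
    have "g s $ 0 = u' s" for s
    proof (cases "s < t")
      case False
      have "(?P *\<^sub>v g s) $ 0 = g s $ 0"
        using signals_dim[OF g_signal] by (simp add: scalar_prod_def numeral_2_eq_2)
      moreover have "?P *\<^sub>v g s = vec 1 (\<lambda>_. u' s)"
        using g(3) False by simp
      ultimately show ?thesis by (metis index_vec less_one)
    qed (use g(2) eq in simp)
    then have "io_signal u' (\<lambda>s. g s $ 1) = g"
      using io_signal_components[OF g_signal] by simp
    then show ?thesis
      using g(1,2) by (intro exI[of _ "\<lambda>s. g s $ 1"]) simp
  qed
  show "\<exists>u y. io_signal u y \<notin> \<B>"
  proof (rule ccontr)
    assume "\<not> ?thesis"
    then have "f \<in> \<B>" if "f \<in> signals 2" for f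
      using io_signal_components[OF that] by metis
    then show False
      using input_card_full_behavior[of 2 \<B>] sub assms(2) by auto
  qed
qed

text \<open>Controllability is applied with the zero trajectory as past.\<close>

lemma controllable_reach:
  assumes "controllable \<B>" and "\<B> \<in> behaviors 2" and "io_signal u y \<in> \<B>"
  shows "\<exists>k v z. io_signal v z \<in> \<B> \<and> (\<forall>s<m. v s = 0 \<and> z s = 0) \<and>
    (\<forall>t. v (k + t) = u t \<and> z (k + t) = y t)"
proof -
  have sub: "\<B> \<subseteq> signals 2" and zero: "(\<lambda>t. 0\<^sub>v 2) \<in> \<B>"
    using assms(2) by (auto simp: behaviors_def linear_behavior_def)
  \<comment> \<open>Controllability speaks of pasts with \<open>T \<ge> 1\<close>, so
    \<open>m\<close> alone would fail for \<open>m = 0\<close>.\<close>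
  let ?T = "Suc m"
  have past: "restrict (\<lambda>t. 0\<^sub>v 2) {0..?T} \<in> restrictions 0 ?T \<B>"
    using zero by (auto simp: restrictions_def)
  have "\<exists>T'\<ge>1. \<exists>w\<in>\<B>. restrict w {0..?T} = restrict (\<lambda>t. 0\<^sub>v 2) {0..?T} \<and>
      (\<forall>t\<ge>?T + T'. w t = io_signal u y (t - ?T - T'))"
    using assms(1)[unfolded controllable_def, THEN spec, THEN mp, THEN bspec, THEN bspec,
        OF _ past assms(3)] by simp
  then obtain T' w where w: "w \<in> \<B>" "restrict w {0..?T} = restrict (\<lambda>t. 0\<^sub>v 2) {0..?T}"
    "\<And>t. ?T + T' \<le> t \<Longrightarrow> w t = io_signal u y (t - ?T - T')"
    by blast
  have "w s = 0\<^sub>v 2" if "s < m" for s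
    using fun_cong[OF w(2), of s] that by simp
  moreover have "w (?T + T' + t) = io_signal u y t" for t
    using w(3)[of "?T + T' + t"] by simp
  moreover have "io_signal (\<lambda>t. w t $ 0) (\<lambda>t. w t $ 1) \<in> \<B>"
    using io_signal_components[of w] w(1) sub by auto
  ultimately show ?thesis
    by (intro exI[of _ "?T + T'"] exI[of _ "\<lambda>t. w t $ 0"] exI[of _ "\<lambda>t. w t $ 1"]) simp
qed

section \<open>McMillan degree, lag and relative degree\<close>

locale siso_state_space = siso_impulse +
  fixes \<B> :: "(nat \<Rightarrow> real vec) set"
  assumes ss_rep_iff: "ss_rep 2 \<B> n A B C D \<longleftrightarrow> siso_rep n A B C D"
begin

lemma mcmillan_degree_eq: "mcmillan_degree 2 \<B> = l"
  unfolding mcmillan_degree_def ss_rep_iff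
  using siso_rep_exists siso_rep_dim_ge by (intro Least_equality) auto

text \<open>With \<open>k\<close> block rows there are \<open>k\<close> rows, so rank
  \<open>l\<close> requires \<open>k \<ge> l\<close>; \<open>l\<close> rows suffice by full row
  rank.\<close>

lemma lag_eq: "lag 2 \<B> = l"
  unfolding lag_def minimal_ss_rep_def mcmillan_degree_eq ss_rep_iff
proof (rule Least_equality)
  show "\<exists>A B C D. siso_rep l A B C D \<and> mat_rank (observability_mat l A C) = l"
    using siso_rep_exists observability_mat_full_rank by blast
  fix k assume "\<exists>A B C D. siso_rep l A B C D \<and> mat_rank (observability_mat k A C) = l"
  then obtain A B C D where rep: "siso_rep l A B C D" "mat_rank (observability_mat k A C) = l"
    by blast
  show "l \<le> k"
    using vec_space.rank_le_nr[OF observability_mat_carrier[OF rep(1), of k]] rep(2)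
      observability_mat_carrier[OF rep(1), of k] by auto
qed

text \<open>Feedthrough and the products \<open>C * A ^\<^sub>m k * B\<close> form one sequence
  \<open>h\<close>; the relative degree is the index of its first nonzero term.\<close>

lemma has_relative_degree_iff:
  assumes "siso_rep n A B C D"
  shows "has_relative_degree A B C D r \<longleftrightarrow>
    (\<exists>q. r = enat q \<and> (\<forall>k<q. h k = 0) \<and> h q \<noteq> 0) \<or> (r = \<infinity> \<and> (\<forall>k. h k = 0))"
proof -
  have c: "A \<in> carrier_mat n n" "B \<in> carrier_mat n 1" "C \<in> carrier_mat 1 n" "D \<in> carrier_mat 1 1"
    using assms by (auto simp: siso_rep_def siso_carriers_def)
  have mat_0_iff: "M = 0\<^sub>m 1 1 \<longleftrightarrow> M $$ (0, 0) = 0" if "M \<in> carrier_mat 1 1" for M :: "real mat"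
    using that by (auto intro!: eq_matI)
  have D: "D = 0\<^sub>m 1 1 \<longleftrightarrow> h 0 = 0"
    using mat_0_iff[OF c(4)] siso_rep_markov(1)[OF assms] by simp
  have "C * A ^\<^sub>m k * B \<in> carrier_mat 1 1" for k
    by (intro mult_carrier_mat[OF mult_carrier_mat[OF c(3) pow_carrier_mat[OF c(1)]] c(2)])
  then have markov: "C * A ^\<^sub>m k * B = 0\<^sub>m 1 1 \<longleftrightarrow> h (Suc k) = 0" for k
    using mat_0_iff siso_rep_markov(2)[OF assms] by simp
  have finite_case: "(\<exists>q. r = enat q \<and> (\<forall>k<q. h k = 0) \<and> h q \<noteq> 0) \<longleftrightarrow>
      (h 0 \<noteq> 0 \<and> r = 0) \<or>
      (h 0 = 0 \<and> (\<exists>q\<ge>1. r = enat q \<and> (\<forall>k<q - 1. h (Suc k) = 0) \<and> h (Suc (q - 1)) \<noteq> 0))"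
    (is "?lhs \<longleftrightarrow> ?rhs")
  proof
    assume ?lhs
    then obtain q where q: "r = enat q" "\<forall>k<q. h k = 0" "h q \<noteq> 0" by blast
    then show ?rhs by (cases q) (auto simp: zero_enat_def)
  next
    assume ?rhs
    then show ?lhs
    proof (elim disjE conjE exE)
      assume "h 0 \<noteq> 0" "r = 0"
      then show ?lhs by (intro exI[of _ 0]) (simp add: zero_enat_def)
    next
      fix q assume q: "h 0 = 0" "1 \<le> q" "r = enat q" "\<forall>k<q - 1. h (Suc k) = 0" "h (Suc (q - 1)) \<noteq> 0"
      have "h k = 0" if "k < q" for k
        using that q(1,4) by (cases k) auto
      then show ?lhs using q by auto
    qed
  qed
  have infinite_case: "(\<forall>k. h k = 0) \<longleftrightarrow> h 0 = 0 \<and> (\<forall>k. h (Suc k) = 0)"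
    by (metis not0_implies_Suc)
  show ?thesis
    unfolding finite_case infinite_case has_relative_degree_def D markov by blast
qed

text \<open>\<open>h\<close> does not depend on the representation, so the definite description has
  a unique value.\<close>

lemma relative_degree_eqI:
  assumes "(\<exists>q. r = enat q \<and> (\<forall>k<q. h k = 0) \<and> h q \<noteq> 0) \<or> (r = \<infinity> \<and> (\<forall>k. h k = 0))"
  shows "relative_degree 2 \<B> = r"
  unfolding relative_degree_def ss_rep_iff
proof (rule the_equality)
  show "\<exists>n A B C D. siso_rep n A B C D \<and> has_relative_degree A B C D r"
    using siso_rep_exists has_relative_degree_iff assms by blast
  fix r' assume "\<exists>n A B C D. siso_rep n A B C D \<and> has_relative_degree A B C D r'"
  then have "(\<exists>q. r' = enat q \<and> (\<forall>k<q. h k = 0) \<and> h q \<noteq> 0) \<or> (r' = \<infinity> \<and> (\<forall>k. h k = 0))"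
    using has_relative_degree_iff by blast
  with assms show "r' = r"
    by (metis linorder_neqE_nat)
qed

end

lemma siso_impulse_state_space:
  assumes "siso_impulse a b (\<lambda>u y. io_signal u y \<in> \<B>) g"
    and "\<B> \<subseteq> signals 2" and "input_card 2 \<B> = 1" and "output_card 2 \<B> = 1"
  shows "siso_state_space a b (\<lambda>u y. io_signal u y \<in> \<B>) g \<B>"
proof -
  interpret siso_impulse a b "\<lambda>u y. io_signal u y \<in> \<B>" g by fact
  show ?thesis
  proof
    fix n A B C D
    have "v @\<^sub>v w \<in> carrier_vec 2" if "v \<in> carrier_vec 1" "w \<in> carrier_vec 1" for v w :: "real vec"
      using append_carrier_vec[OF that] by (simp add: numeral_2_eq_2)
    then have sub: "ss_behavior n 1 1 A B C D \<subseteq> signals 2"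
      by (auto simp: ss_behavior_def signals_def)
    have "\<B> = ss_behavior n 1 1 A B C D \<longleftrightarrow>
        (\<forall>u y. io_signal u y \<in> \<B> \<longleftrightarrow> io_signal u y \<in> ss_behavior n 1 1 A B C D)"
    proof
      assume eq: "\<forall>u y. io_signal u y \<in> \<B> \<longleftrightarrow> io_signal u y \<in> ss_behavior n 1 1 A B C D"
      show "\<B> = ss_behavior n 1 1 A B C D"
      proof (rule Set.set_eqI)
        fix f
        show "f \<in> \<B> \<longleftrightarrow> f \<in> ss_behavior n 1 1 A B C D"
        proof (cases "f \<in> signals 2")
          case True
          show ?thesis
            using eq[rule_format, of "\<lambda>t. f t $ 0" "\<lambda>t. f t $ 1"]
            by (simp only: io_signal_components[OF True])
        qed (use sub assms(2) in blast)
      qed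
    qed auto
    then show "ss_rep 2 \<B> n A B C D \<longleftrightarrow> siso_rep n A B C D"
      using ss_behavior_siso_iff[of n A B C D] assms(3,4)
      by (auto simp: ss_rep_def siso_rep_def siso_carriers_def)
  qed
qed

section \<open>The relative degree read off from data\<close>

theorem theorem10:
  fixes \<B> :: "(nat \<Rightarrow> real vec) set" and u\<^sub>d y\<^sub>d :: "nat \<Rightarrow> real vec" and T L :: nat
  defines "n \<equiv> mcmillan_degree 2 \<B>" and "l \<equiv> lag 2 \<B>"
  defines "row_condition \<equiv> \<lambda>j.
    nth_row (hankel 1 T L y\<^sub>d) (l + j) \<notin>
      mat_im (row_range (hankel 1 T L u\<^sub>d) 1 l @\<^sub>r row_range (hankel 1 T L y\<^sub>d) 1 l)\<^sup>T"
  assumes "\<B> \<in> behaviors 2" and "controllable \<B>"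
    and "input_card 2 \<B> = 1" and "output_card 2 \<B> = 1" and "io_partitioned 2 \<B>"
    and "\<And>t. t \<le> T \<Longrightarrow> u\<^sub>d t \<in> carrier_vec 1 \<and> y\<^sub>d t \<in> carrier_vec 1"
    and "(\<lambda>t\<in>{0..T}. u\<^sub>d t @\<^sub>v y\<^sub>d t) \<in> restrictions 0 T \<B>"
    and "L \<ge> l + n + 1"
    and "persistently_exciting 1 T (L + n) u\<^sub>d"
  shows "({j. 1 \<le> j \<and> j \<le> L - l \<and> row_condition j} \<noteq> {} \<longrightarrow>
           relative_degree 2 \<B> = enat (Min {j. 1 \<le> j \<and> j \<le> L - l \<and> row_condition j} - 1)) \<and>
         ((\<nexists>j. 1 \<le> j \<and> j \<le> n + 1 \<and> row_condition j) \<longrightarrow> relative_degree 2 \<B> = \<infinity>)"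
proof -
  let ?W = "\<lambda>u y. io_signal u y \<in> \<B>"
  have sub: "\<B> \<subseteq> signals 2"
    using assms(4) by (simp add: behaviors_def linear_behavior_def)
  interpret beh: siso_behavior ?W
    by (rule siso_behavior_io) fact+
  obtain a b where "siso_kernel a b ?W"
    using beh.kernel_representation by blast
  then interpret siso_kernel a b ?W .
  obtain g where g: "?W (\<lambda>t. if t = degree a then 1 else 0) g" "\<forall>s<degree a. g s = 0"
    using initial[of "\<lambda>t. if t = degree a then 1 else 0" "\<lambda>_. 0"] by blast
  have "siso_impulse a b ?W g"
    by unfold_locales (use g in auto)
  then interpret siso_state_space a b ?W g \<B>
    by (rule siso_impulse_state_space) fact+
  have n: "n = degree a" and l: "l = degree a"
    by (simp_all add: n_def l_def mcmillan_degree_eq lag_eq)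
  have coprime: "coprime a b"
    by (rule reachable_imp_coprime) (rule controllable_reach[OF assms(5,4)])
  \<comment> \<open>The data are the beginning of a full trajectory, to which the kernel results
    apply.\<close>
  obtain f where f: "f \<in> \<B>" "restrict f {0..T} = (\<lambda>t\<in>{0..T}. u\<^sub>d t @\<^sub>v y\<^sub>d t)"
    using assms(10) by (auto simp: restrictions_def)
  define u where "u = (\<lambda>t. f t $ 0)"
  define y where "y = (\<lambda>t. f t $ 1)"
  have W: "?W u y"
    using io_signal_components[of f] f(1) sub by (auto simp: u_def y_def)
  have data: "u\<^sub>d t $ 0 = u t" "y\<^sub>d t $ 0 = y t" if "t \<le> T" for t
  proof -
    have "f t = u\<^sub>d t @\<^sub>v y\<^sub>d t"
      using fun_cong[OF f(2), of t] that by simp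
    then show "u\<^sub>d t $ 0 = u t" "y\<^sub>d t $ 0 = y t"
      using assms(9)[OF that] by (simp_all add: u_def y_def append_scalars)
  qed
  \<comment> \<open>The number of columns of the input Hankel matrix of order \<open>L + l\<close>;
    the one of order \<open>L\<close> has \<open>l\<close> more.\<close>
  define M where "M = T + 2 - (L + l)"
  have L: "L + l \<le> T + 1" "2 * l + 1 \<le> L"
    using assms(11,12) by (auto simp: persistently_exciting_def n l)
  have pe: "\<forall>i<L + l. c i = 0" if vanish: "\<And>j. j < M \<Longrightarrow> (\<Sum>i<L + l. c i * u (i + j)) = 0" for c
  proof (intro allI impI)
    fix i assume "i < L + l"
    moreover have "(\<Sum>i<L + l. c i * u\<^sub>d (i + j) $ 0) = 0" if j: "j < T + 2 - (L + l)" for j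
    proof -
      have "(\<Sum>i<L + l. c i * u\<^sub>d (i + j) $ 0) = (\<Sum>i<L + l. c i * u (i + j))"
        using j data(1) by (intro sum.cong) auto
      then show ?thesis using vanish[of j] j by (simp add: M_def)
    qed
    ultimately show "c i = 0"
      using persistently_exciting_scalarD[of T "L + l" u\<^sub>d c i] assms(12) by (simp add: n l)
  qed
  \<comment> \<open>Row \<open>l + k + 1\<close>, counted from 1, starts with the output at time
    \<open>l + k\<close>. Once the condition holds it persists for larger \<open>k\<close>.\<close>
  have row_condition: "row_condition (Suc k) \<longleftrightarrow> (\<exists>m\<le>k. h m \<noteq> 0)" if k: "l + k < L" for k
  proof -
    let ?N = "T + 2 - L"
    let ?U = "hankel 1 T L u\<^sub>d" and ?Y = "hankel 1 T L y\<^sub>d"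
    have U: "?U $$ (i, j) = u (i + j)" and Y: "?Y $$ (i, j) = y (i + j)" if "i < L" "j < ?N" for i j
      unfolding hankel_scalar_index[OF that] using that by (intro data; simp)+
    have carrier: "nth_row ?Y (l + Suc k) \<in> carrier_vec ?N"
      by (intro carrier_vecI) (simp add: nth_row_def hankel_def)
    have row: "nth_row ?Y (l + Suc k) $ j = y (l + k + j)" if "j < ?N" for j
      using that k Y[of "l + k" j] hankel_scalar_carrier[of T L y\<^sub>d]
      by (auto simp: nth_row_def simp del: One_nat_def)
    have span_eq: "nth_row ?Y (l + Suc k) $ j =
        (\<Sum>i<l. p i * ?U $$ (i, j)) + (\<Sum>i<l. q i * ?Y $$ (i, j)) \<longleftrightarrow>
        y (l + k + j) = (\<Sum>i<l. p i * u (i + j)) + (\<Sum>i<l. q i * y (i + j))"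
      if j: "j < ?N" for j p q
    proof -
      have "(\<Sum>i<l. p i * ?U $$ (i, j)) = (\<Sum>i<l. p i * u (i + j))"
        by (intro sum.cong refl arg_cong2[of _ _ _ _ times] U j) (use L in simp)
      moreover have "(\<Sum>i<l. q i * ?Y $$ (i, j)) = (\<Sum>i<l. q i * y (i + j))"
        by (intro sum.cong refl arg_cong2[of _ _ _ _ times] Y j) (use L in simp)
      ultimately show ?thesis by (simp only: row[OF j])
    qed
    have "row_condition (Suc k) \<longleftrightarrow> \<not> (\<exists>p q. \<forall>j<?N. nth_row ?Y (l + Suc k) $ j =
        (\<Sum>i<l. p i * ?U $$ (i, j)) + (\<Sum>i<l. q i * ?Y $$ (i, j)))"
      unfolding row_condition_def
      using hankel_scalar_carrier[of T L u\<^sub>d] hankel_scalar_carrier[of T L y\<^sub>d]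
      by (subst mat_im_row_ranges[OF _ _ carrier]) auto
    also have "\<dots> \<longleftrightarrow> \<not> (\<exists>p q. \<forall>j<?N. y (l + k + j) =
        (\<Sum>i<l. p i * u (i + j)) + (\<Sum>i<l. q i * y (i + j)))"
      by (intro arg_cong[of _ _ Not] ex_cong1 all_cong1 imp_cong refl span_eq)
    also have "?N = M + degree a"
      using L by (simp add: M_def l)
    also have "\<not> (\<exists>p q. \<forall>j<M + degree a. y (l + k + j) =
        (\<Sum>i<l. p i * u (i + j)) + (\<Sum>i<l. q i * y (i + j))) \<longleftrightarrow> \<not> (\<forall>m\<le>k. h m = 0)"
      using output_row_in_span_iff[OF coprime W k[unfolded l] pe[unfolded l]] by (simp only: l)
    finally show ?thesis by simp
  qed
  let ?J = "{j. 1 \<le> j \<and> j \<le> L - l \<and> row_condition j}"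
  have J_iff: "j \<in> ?J \<longleftrightarrow> (\<exists>k. j = Suc k \<and> l + k < L \<and> (\<exists>m\<le>k. h m \<noteq> 0))" for j
    using row_condition[of "j - 1"] by (cases j) auto
  have "relative_degree 2 \<B> = enat (Min ?J - 1)" if nonempty: "?J \<noteq> {}"
  proof -
    \<comment> \<open>The condition first holds at \<open>k = q\<close>, that is at
      \<open>j = Suc q\<close>, which explains the subtraction of 1.\<close>
    define q where "q = (LEAST m. h m \<noteq> 0)"
    obtain k m where km: "l + k < L" "m \<le> k" "h m \<noteq> 0"
      using nonempty J_iff by blast
    have q: "h q \<noteq> 0" "\<And>k. h k \<noteq> 0 \<Longrightarrow> q \<le> k"
      unfolding q_def by (rule LeastI[of "\<lambda>m. h m \<noteq> 0", OF km(3)]) (rule Least_le)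
    have "Min ?J = Suc q"
    proof (rule Min_eqI)
      show "finite ?J" by (rule finite_subset[of _ "{..L - l}"]) auto
      show "Suc q \<le> j" if "j \<in> ?J" for j
        using that q(2) unfolding J_iff by (meson Suc_le_mono le_trans)
      show "Suc q \<in> ?J"
        unfolding J_iff using km(1,2) q(1) q(2)[OF km(3)] by (intro exI[of _ q]) auto
    qed
    moreover have "relative_degree 2 \<B> = enat q"
      using q by (intro relative_degree_eqI disjI1 exI[of _ q]) (auto dest: leD)
    ultimately show ?thesis by simp
  qed
  moreover have "relative_degree 2 \<B> = \<infinity>" if none: "\<nexists>j. 1 \<le> j \<and> j \<le> n + 1 \<and> row_condition j"
  proof -
    \<comment> \<open>The bound \<open>2 * l + 1 \<le> L\<close> ensures that rows
      \<open>l + 1\<close> to \<open>2 * l + 1\<close> are all available.\<close>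
    have "h k = 0" if "k < degree a + 1" for k
      using none row_condition[of k] that L by (auto simp: n l)
    then have "h k = 0" for k
      by (rule h_eventually_zero)
    then show ?thesis
      by (intro relative_degree_eqI) simp
  qed
  ultimately show ?thesis by blast
qed

end
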